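(* A formula $\varphi$ of $\mathrm{SL}(\ast,\mathrm{alloc})$ is valid if and only if $\vdash_{\mathsf{C}(\ast)}\varphi$.
   Context: Logic $\mathrm{SL}(\ast,\mathrm{alloc})$: fix a countably infinite set $\mathrm{PVAR}$ of program variables and a countably infinite set $\mathrm{LOC}$ of locations. Formulae: $\varphi ::= x = y \mid x \hookrightarrow y \mid \mathrm{emp}\mid \mathrm{alloc}(x) \mid \neg\varphi \mid \varphi\wedge\varphi \mid \varphi \ast \varphi$ ($x,y\in\mathrm{PVAR}$). Memory states $(s,h)$: $s:\mathrm{PVAR}\to\mathrm{LOC}$, $h$ a partial function $\mathrm{LOC}\to\mathrm{LOC}$ with finite domain. $(s,h)\models x=y$ iff $s(x)=s(y)$; $\models\mathrm{emp}$ iff $\mathrm{dom}(h)=\emptyset$; $\models x\hookrightarrow y$ iff $s(x)\in\mathrm{dom}(h)$ and $h(s(x))=s(y)$; $\models\mathrm{alloc}(x)$ iff $s(x)\in\mathrm{dom}(h)$; Boolean connectives as usual; $\models\varphi_1\ast\varphi_2$ iff $h$ splits into two domain-disjoint heaps $h_1,h_2$ ($h=h_1+h_2$) with $(s,h_i)\models\varphi_i$. Valid = satisfied by all memory states. Abbreviations: $\bot:=\neg(x=x)$, $\top:=\neg\bot$, $\mathrm{size}\ge0:=\top$, $\mathrm{size}\ge1:=\neg\mathrm{emp}$, $\mathrm{size}\ge\beta:=\neg\mathrm{emp}\ast\mathrm{size}\ge\beta-1$ for $\beta\ge2$; $\mathrm{size}=\beta:=\mathrm{size}\ge\beta\wedge\neg\,\mathrm{size}\ge\beta+1$;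 $a\dot-b=\max(0,a-b)$. The proof system $\mathsf{C}(\ast)$ (derivability is the least set of formulae containing all instances of the axiom schemata, metavariables ranging over formulae, variables and naturals, and closed under the rules) consists of all axiom schemata of classical propositional calculus, modus ponens, and: (1) $x=x$; (2) $\varphi\wedge x=y\Rightarrow\varphi'$, where $\varphi'$ is obtained from $\varphi$ by replacing every occurrence of $y$ with $x$; (3) $x\hookrightarrow y\Rightarrow\mathrm{alloc}(x)$; (4) $(x\hookrightarrow y\wedge x\hookrightarrow z)\Rightarrow y=z$; (7) $(\varphi\ast\psi)\Leftrightarrow(\psi\ast\varphi)$; (8) $((\varphi\ast\psi)\ast\chi)\Leftrightarrow(\varphi\ast(\psi\ast\chi))$; (9) $((\varphi\vee\psi)\ast\chi)\Rightarrow((\varphi\ast\chi)\vee(\psi\ast\chi))$; (10) $(\bot\ast\varphi)\Leftrightarrow\bot$; (11) $\varphi\Leftrightarrow(\varphi\ast\mathrm{emp})$; (12) $(\mathrm{alloc}(x)\ast\top)\Rightarrow\mathrm{alloc}(x)$; (13) $(\mathrm{alloc}(x)\ast\mathrm{alloc}(x))\Leftrightarrow\bot$; (14) $(\xi\ast\top)\Rightarrow\xi$ for $\xi\in\{\neg\mathrm{emp},\ x=y,\ \neg(x=y),\ x\hookrightarrow y\}$; (15) $(\neg\mathrm{alloc}(x)\ast\neg\mathrm{alloc}(x))\Rightarrow\neg\mathrm{alloc}(x)$; (16) $((\mathrm{alloc}(x)\wedge\neg x\hookrightarrow y)\ast\top)\Rightarrow\neg x\hookrightarrow y$; (17) $\mathrm{alloc}(x)\Rightarrow((\mathrm{alloc}(x)\wedge\mathrm{size}=1)\ast\top)$;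 (18) $\neg\mathrm{emp}\Rightarrow(\mathrm{size}=1\ast\top)$; (19) $(\neg\,\mathrm{size}\ge\beta_1\ast\neg\,\mathrm{size}\ge\beta_2)\Rightarrow\neg\,\mathrm{size}\ge\beta_1+\beta_2\dot-1$; (20) $(\mathrm{alloc}(x)\wedge\mathrm{alloc}(y)\wedge\neg(x=y))\Rightarrow\mathrm{size}\ge2$; and the rule: from $\varphi\Rightarrow\chi$ infer $(\varphi\ast\psi)\Rightarrow(\chi\ast\psi)$. *)

theory Defs
  imports "HOL-Library.Countable" "HOL-Library.Infinite_Typeclass"
begin

datatype 'v form =
    Eq 'v 'v            (infix "\<^bold>=" 70)
  | Pto 'v 'v           (infix "\<hookrightarrow>" 70)
  | Emp
  | Alloc 'v
  | Neg "'v form"       ("\<^bold>\<not> _" [65] 65)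
  | And "'v form" "'v form"   (infixr "\<^bold>\<and>" 55)
  | Star "'v form" "'v form"  (infixr "\<^bold>*" 60)

text \<open>A heap is a map \<open>'l \<rightharpoonup> 'l\<close>; finiteness of its domain is imposed in \<open>valid\<close> below,
  and is inherited by every subheap considered in the clause for the separating conjunction.\<close>

primrec sat :: "('v \<Rightarrow> 'l) \<Rightarrow> ('l \<rightharpoonup> 'l) \<Rightarrow> 'v form \<Rightarrow> bool" where
  "sat s h (x \<^bold>= y) \<longleftrightarrow> s x = s y"
| "sat s h (x \<hookrightarrow> y) \<longleftrightarrow> h (s x) = Some (s y)"
| "sat s h Emp \<longleftrightarrow> dom h = {}"
| "sat s h (Alloc x) \<longleftrightarrow> s x \<in> dom h"
| "sat s h (\<^bold>\<not> \<phi>) \<longleftrightarrow> \<not> sat s h \<phi>"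
| "sat s h (\<phi> \<^bold>\<and> \<psi>) \<longleftrightarrow> sat s h \<phi> \<and> sat s h \<psi>"
| "sat s h (\<phi> \<^bold>* \<psi>) \<longleftrightarrow>
    (\<exists>h1 h2. dom h1 \<inter> dom h2 = {} \<and> h = h1 ++ h2 \<and> sat s h1 \<phi> \<and> sat s h2 \<psi>)"

text \<open>The first argument only fixes the type of locations, which does not occur in formulae.\<close>

definition valid :: "'l itself \<Rightarrow> 'v form \<Rightarrow> bool" where
  "valid _ \<phi> \<longleftrightarrow> (\<forall>(s :: 'v \<Rightarrow> 'l) (h :: 'l \<rightharpoonup> 'l). finite (dom h) \<longrightarrow> sat s h \<phi>)"

abbreviation Or (infixr "\<^bold>\<or>" 50) where
  "\<phi> \<^bold>\<or> \<psi> \<equiv> \<^bold>\<not> (\<^bold>\<not> \<phi> \<^bold>\<and> \<^bold>\<not> \<psi>)"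

abbreviation Imp (infixr "\<^bold>\<longrightarrow>" 45) where
  "\<phi> \<^bold>\<longrightarrow> \<psi> \<equiv> \<^bold>\<not> (\<phi> \<^bold>\<and> \<^bold>\<not> \<psi>)"

abbreviation Iff (infix "\<^bold>\<longleftrightarrow>" 44) where
  "\<phi> \<^bold>\<longleftrightarrow> \<psi> \<equiv> (\<phi> \<^bold>\<longrightarrow> \<psi>) \<^bold>\<and> (\<psi> \<^bold>\<longrightarrow> \<phi>)"

text \<open>\<open>undefined\<close> is the fixed but arbitrary program variable \<open>x\<close> in \<open>\<bottom> := \<not>(x = x)\<close>.\<close>

abbreviation Bot :: "'v form" where
  "Bot \<equiv> \<^bold>\<not> (undefined \<^bold>= undefined)"

abbreviation Top :: "'v form" where
  "Top \<equiv> \<^bold>\<not> Bot"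

fun size_ge :: "nat \<Rightarrow> 'v form" where
  "size_ge 0 = Top"
| "size_ge (Suc 0) = \<^bold>\<not> Emp"
| "size_ge (Suc (Suc n)) = \<^bold>\<not> Emp \<^bold>* size_ge (Suc n)"

definition size_eq :: "nat \<Rightarrow> 'v form" where
  "size_eq n = size_ge n \<^bold>\<and> \<^bold>\<not> size_ge (n + 1)"

text \<open>The schemata \<open>PC1\<close>--\<open>PC6\<close> with modus ponens axiomatise classical propositional
  calculus over negation and conjunction, implication being the abbreviation above.\<close>

inductive derivable :: "'v form \<Rightarrow> bool" ("\<turnstile> _" [40] 40) where
  PC1: "\<turnstile> \<phi> \<^bold>\<longrightarrow> (\<psi> \<^bold>\<longrightarrow> \<phi>)"
| PC2: "\<turnstile> (\<phi> \<^bold>\<longrightarrow> (\<psi> \<^bold>\<longrightarrow> \<chi>)) \<^bold>\<longrightarrow> ((\<phi> \<^bold>\<longrightarrow> \<psi>) \<^bold>\<longrightarrow> (\<phi> \<^bold>\<longrightarrow> \<chi>))"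
| PC3: "\<turnstile> (\<^bold>\<not> \<phi> \<^bold>\<longrightarrow> \<^bold>\<not> \<psi>) \<^bold>\<longrightarrow> (\<psi> \<^bold>\<longrightarrow> \<phi>)"
| PC4: "\<turnstile> (\<phi> \<^bold>\<and> \<psi>) \<^bold>\<longrightarrow> \<phi>"
| PC5: "\<turnstile> (\<phi> \<^bold>\<and> \<psi>) \<^bold>\<longrightarrow> \<psi>"
| PC6: "\<turnstile> \<phi> \<^bold>\<longrightarrow> (\<psi> \<^bold>\<longrightarrow> (\<phi> \<^bold>\<and> \<psi>))"
| MP: "\<turnstile> \<phi> \<^bold>\<longrightarrow> \<psi> \<Longrightarrow> \<turnstile> \<phi> \<Longrightarrow> \<turnstile> \<psi>"
| Ax1: "\<turnstile> x \<^bold>= x"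
| Ax2: "\<turnstile> (\<phi> \<^bold>\<and> (x \<^bold>= y)) \<^bold>\<longrightarrow> map_form (\<lambda>z. if z = y then x else z) \<phi>"
| Ax3: "\<turnstile> (x \<hookrightarrow> y) \<^bold>\<longrightarrow> Alloc x"
| Ax4: "\<turnstile> ((x \<hookrightarrow> y) \<^bold>\<and> (x \<hookrightarrow> z)) \<^bold>\<longrightarrow> (y \<^bold>= z)"
| Ax7: "\<turnstile> (\<phi> \<^bold>* \<psi>) \<^bold>\<longleftrightarrow> (\<psi> \<^bold>* \<phi>)"
| Ax8: "\<turnstile> ((\<phi> \<^bold>* \<psi>) \<^bold>* \<chi>) \<^bold>\<longleftrightarrow> (\<phi> \<^bold>* (\<psi> \<^bold>* \<chi>))"
| Ax9: "\<turnstile> ((\<phi> \<^bold>\<or> \<psi>) \<^bold>* \<chi>) \<^bold>\<longrightarrow> ((\<phi> \<^bold>* \<chi>) \<^bold>\<or> (\<psi> \<^bold>* \<chi>))"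
| Ax10: "\<turnstile> (Bot \<^bold>* \<phi>) \<^bold>\<longleftrightarrow> Bot"
| Ax11: "\<turnstile> \<phi> \<^bold>\<longleftrightarrow> (\<phi> \<^bold>* Emp)"
| Ax12: "\<turnstile> (Alloc x \<^bold>* Top) \<^bold>\<longrightarrow> Alloc x"
| Ax13: "\<turnstile> (Alloc x \<^bold>* Alloc x) \<^bold>\<longleftrightarrow> Bot"
| Ax14: "\<xi> \<in> {\<^bold>\<not> Emp, x \<^bold>= y, \<^bold>\<not> (x \<^bold>= y), x \<hookrightarrow> y} \<Longrightarrow> \<turnstile> (\<xi> \<^bold>* Top) \<^bold>\<longrightarrow> \<xi>"
| Ax15: "\<turnstile> ((\<^bold>\<not> Alloc x) \<^bold>* (\<^bold>\<not> Alloc x)) \<^bold>\<longrightarrow> \<^bold>\<not> Alloc x"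
| Ax16: "\<turnstile> ((Alloc x \<^bold>\<and> \<^bold>\<not> (x \<hookrightarrow> y)) \<^bold>* Top) \<^bold>\<longrightarrow> \<^bold>\<not> (x \<hookrightarrow> y)"
| Ax17: "\<turnstile> Alloc x \<^bold>\<longrightarrow> ((Alloc x \<^bold>\<and> size_eq 1) \<^bold>* Top)"
| Ax18: "\<turnstile> \<^bold>\<not> Emp \<^bold>\<longrightarrow> (size_eq 1 \<^bold>* Top)"
| Ax19: "\<turnstile> ((\<^bold>\<not> size_ge \<beta>\<^sub>1) \<^bold>* (\<^bold>\<not> size_ge \<beta>\<^sub>2)) \<^bold>\<longrightarrow> \<^bold>\<not> size_ge (\<beta>\<^sub>1 + \<beta>\<^sub>2 - 1)"
| Ax20: "\<turnstile> (Alloc x \<^bold>\<and> Alloc y \<^bold>\<and> \<^bold>\<not> (x \<^bold>= y)) \<^bold>\<longrightarrow> size_ge 2"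
| StarMono: "\<turnstile> \<phi> \<^bold>\<longrightarrow> \<chi> \<Longrightarrow> \<turnstile> (\<phi> \<^bold>* \<psi>) \<^bold>\<longrightarrow> (\<chi> \<^bold>* \<psi>)"

end

theory Submission
  imports Defs
begin

text \<open>Completeness uses the canonical model: the maximal consistent sets with the relation
  \<open>joins \<Gamma> \<Gamma>\<^sub>1 \<Gamma>\<^sub>2\<close>, meaning that \<open>\<phi> * \<psi> \<in> \<Gamma>\<close> whenever \<open>\<phi> \<in> \<Gamma>\<^sub>1\<close> and \<open>\<psi> \<in> \<Gamma>\<^sub>2\<close>, behave like
  abstract heaps with disjoint union: the axioms make \<open>alloc\<close> and \<open>\<hookrightarrow>\<close> distribute over \<open>joins\<close>, make the
  size additive, and permit splitting off single cells. Call a maximal consistent set and a memory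
  state similar if they agree on equalities, points-to and \<open>alloc\<close> over a finite set \<open>X\<close> of variables
  and on \<open>size \<ge> \<beta>\<close> for \<open>\<beta> \<le> \<alpha>\<close>. If \<open>\<alpha> \<ge> \<alpha>\<^sub>1 + \<alpha>\<^sub>2\<close> with \<open>\<alpha>\<^sub>1, \<alpha>\<^sub>2 \<ge> |X|\<close>, a split on either side can be
  followed by one on the other side, similar up to \<open>\<alpha>\<^sub>1\<close> and \<open>\<alpha>\<^sub>2\<close>. Hence similar pairs agree on all
  formulae over \<open>X\<close> that are small compared with \<open>\<alpha>\<close>, and every maximal consistent set is similar to
  some memory state.\<close>

section \<open>Soundness\<close>

lemma finite_dom_add:
  "h = h1 ++ h2 \<Longrightarrow> finite (dom h) \<Longrightarrow> finite (dom h1) \<and> finite (dom h2)"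
  by auto

lemma split_heap:
  assumes "D \<subseteq> dom h"
  shows "dom (h |` D) = D" "dom (h |` (- D)) = dom h - D" "h = (h |` D) ++ (h |` (- D))"
  using assms by (auto simp: map_add_def restrict_map_def fun_eq_iff split: option.splits if_splits)

text \<open>Moves a renaming into the store. Soundness of \<open>Ax2\<close> follows, since the
  store composed with the replacement of \<open>y\<close> by \<open>x\<close> is unchanged when
  \<open>s x = s y\<close>.\<close>

lemma sat_map_form: "sat s h (map_form f \<phi>) \<longleftrightarrow> sat (s \<circ> f) h \<phi>"
  by (induction \<phi> arbitrary: h) auto

lemma sat_size_ge: "finite (dom h) \<Longrightarrow> sat s h (size_ge n) \<longleftrightarrow> n \<le> card (dom h)"
proof (induction n arbitrary: h rule: size_ge.induct)
  case 1
  then show ?case by simp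
next
  case 2
  then show ?case by (auto simp: Suc_le_eq card_gt_0_iff)
next
  case (3 n)
  show ?case
  proof
    assume "sat s h (size_ge (Suc (Suc n)))"
    then obtain h1 h2 where h: "dom h1 \<inter> dom h2 = {}" "h = h1 ++ h2" "dom h1 \<noteq> {}"
      and s: "sat s h2 (size_ge (Suc n))" by auto
    have f: "finite (dom h1)" "finite (dom h2)" using h "3.prems" by auto
    then have "Suc n \<le> card (dom h2)" using s "3.IH" by blast
    moreover have "card (dom h) = card (dom h1) + card (dom h2)"
      using h f by (simp add: card_Un_disjoint Un_commute)
    moreover have "card (dom h1) > 0" using h f by (simp add: card_gt_0_iff)
    ultimately show "Suc (Suc n) \<le> card (dom h)" by linarith
  next
    assume c: "Suc (Suc n) \<le> card (dom h)"
    then obtain l where l: "l \<in> dom h" by (metis card.empty equals0I not_less_eq_eq le0)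
    let ?h1 = "h |` {l}" and ?h2 = "h |` (- {l})"
    have d: "dom ?h1 = {l}" "dom ?h2 = dom h - {l}" and eq: "h = ?h1 ++ ?h2"
      using split_heap[of "{l}" h] l by auto
    have "sat s ?h2 (size_ge (Suc n))"
      using c l "3.prems" by (subst "3.IH") (auto simp: d(2) simp del: dom_restrict)
    moreover have "sat s ?h1 (\<^bold>\<not> Emp)" by (simp add: d(1) del: dom_restrict)
    ultimately show "sat s h (size_ge (Suc (Suc n)))"
      unfolding size_ge.simps sat.simps(7) using d eq by blast
  qed
qed

lemma sat_Star_comm: "sat s h (\<phi> \<^bold>* \<psi>) \<Longrightarrow> sat s h (\<psi> \<^bold>* \<phi>)"
  by (simp, metis Int_commute map_add_comm)

lemma sat_Star_assoc: "sat s h ((\<phi> \<^bold>* \<psi>) \<^bold>* \<chi>) \<Longrightarrow> sat s h (\<phi> \<^bold>* (\<psi> \<^bold>* \<chi>))"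
proof -
  assume "sat s h ((\<phi> \<^bold>* \<psi>) \<^bold>* \<chi>)"
  then obtain h1 h2 h3 where *: "dom (h1 ++ h2) \<inter> dom h3 = {}" "h = (h1 ++ h2) ++ h3"
     "dom h1 \<inter> dom h2 = {}" "sat s h1 \<phi>" "sat s h2 \<psi>" "sat s h3 \<chi>" by auto
  then have "dom h2 \<inter> dom h3 = {}" "dom h1 \<inter> dom (h2 ++ h3) = {}" "h = h1 ++ (h2 ++ h3)" by auto
  then show ?thesis using * unfolding sat.simps(7) by blast
qed

text \<open>Covers \<open>Ax17\<close> and \<open>Ax18\<close> together, with \<open>Alloc x\<close>
  and \<open>Top\<close> in the role of \<open>\<phi>\<close>.\<close>

lemma sat_split_cell:
  assumes "l \<in> dom h" "finite (dom h)" "sat s (h |` {l}) \<phi>"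
  shows "sat s h ((\<phi> \<^bold>\<and> size_eq 1) \<^bold>* Top)"
proof -
  let ?h1 = "h |` {l}" and ?h2 = "h |` (- {l})"
  have d: "dom ?h1 = {l}" "dom ?h2 = dom h - {l}" and eq: "h = ?h1 ++ ?h2"
    using split_heap[of "{l}" h] assms(1) by auto
  have "sat s ?h1 (\<phi> \<^bold>\<and> size_eq 1)"
    using assms(3) d(1) by (simp add: size_eq_def sat_size_ge del: dom_restrict size_ge.simps)
  then show ?thesis using d eq unfolding sat.simps(7) by (metis Diff_disjoint sat.simps(1,5))
qed

lemma sound: "\<turnstile> \<phi> \<Longrightarrow> finite (dom h) \<Longrightarrow> sat s h \<phi>"
proof (induction arbitrary: h rule: derivable.induct)
  case (Ax2 \<phi> x y)
  have "s \<circ> (\<lambda>z. if z = y then x else z) = s" if "s x = s y" using that by auto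
  then show ?case by (auto simp: sat_map_form)
next
  case (Ax7 \<phi> \<psi>)
  then show ?case using sat_Star_comm by (auto simp del: sat.simps(7))
next
  case (Ax8 \<phi> \<psi> \<chi>)
  then show ?case using sat_Star_comm sat_Star_assoc by (simp del: sat.simps(7)) blast
next
  case (Ax11 \<phi>)
  have "sat s h (\<phi> \<^bold>* Emp)" if "sat s h \<phi>"
    unfolding sat.simps(7) by (rule exI[of _ h], rule exI[of _ Map.empty]) (use that in auto)
  then show ?case by auto
next
  case (Ax14 \<xi> x y)
  have "(h1 ++ h2) (s x) = Some (s y)"
    if "dom h1 \<inter> dom h2 = {}" "h1 (s x) = Some (s y)" for h1 h2 :: "'b \<rightharpoonup> 'b"
    using that by (metis map_add_comm map_add_find_right)
  moreover have "dom (h1 ++ h2) \<noteq> {}" if "dom h1 \<noteq> {}" for h1 h2 :: "'b \<rightharpoonup> 'b"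
    using that by (simp del: dom_eq_empty_conv)
  ultimately show ?case using Ax14 by (auto simp del: dom_eq_empty_conv)
next
  case (Ax17 x)
  then show ?case using sat_split_cell[of "s x" h s "Alloc x"] by (auto simp del: sat.simps(7))
next
  case Ax18
  have "sat s h (size_eq 1 \<^bold>* Top)" if ne: "dom h \<noteq> {}"
  proof -
    obtain l where "l \<in> dom h" using ne by blast
    then have "sat s h ((Top \<^bold>\<and> size_eq 1) \<^bold>* Top)" by (rule sat_split_cell) (use Ax18 in simp_all)
    then show ?thesis unfolding sat.simps(6,7) by blast
  qed
  then show ?case by (auto simp del: sat.simps(7))
next
  case (Ax19 b1 b2)
  show ?case
  proof (clarsimp simp del: size_ge.simps)
    fix h1 h2 :: "'b \<rightharpoonup> 'b"
    assume h: "dom h1 \<inter> dom h2 = {}" "h = h1 ++ h2" and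
      n: "\<not> sat s h1 (size_ge b1)" "\<not> sat s h2 (size_ge b2)"
      and s: "sat s (h1 ++ h2) (size_ge (b1 + b2 - Suc 0))"
    have f: "finite (dom h1)" "finite (dom h2)" using h Ax19 by auto
    moreover have "card (dom h) = card (dom h1) + card (dom h2)"
      using h f by (simp add: card_Un_disjoint Un_commute)
    ultimately show False using n s Ax19 h(2) by (simp add: sat_size_ge)
  qed
next
  case (Ax20 x y)
  have "2 \<le> card (dom h)" if "s x \<in> dom h" "s y \<in> dom h" "s x \<noteq> s y"
    using card_mono[of "dom h" "{s x, s y}"] that Ax20 by auto
  then show ?case using Ax20 by (auto simp: sat_size_ge domI simp del: size_ge.simps)
next
  case (StarMono \<phi> \<chi> \<psi>)
  then show ?case by (auto, metis finite_dom_add finite_UnI)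
qed (auto simp: dom_def map_add_def split: option.splits)


section \<open>Maximal consistent sets\<close>

text \<open>Closure is under modus ponens alone: \<open>StarMono\<close> preserves derivability, but
  a theory that contains an implication may lack its starred version.\<close>

definition thy :: "'v form set \<Rightarrow> bool" where
  "thy F \<longleftrightarrow> (\<forall>\<phi>. \<turnstile> \<phi> \<longrightarrow> \<phi> \<in> F) \<and> (\<forall>\<phi> \<psi>. (\<phi> \<^bold>\<longrightarrow> \<psi>) \<in> F \<longrightarrow> \<phi> \<in> F \<longrightarrow> \<psi> \<in> F)"

lemma thy_derivable: "thy F \<Longrightarrow> \<turnstile> \<phi> \<Longrightarrow> \<phi> \<in> F"
  and thy_MP: "thy F \<Longrightarrow> (\<phi> \<^bold>\<longrightarrow> \<psi>) \<in> F \<Longrightarrow> \<phi> \<in> F \<Longrightarrow> \<psi> \<in> F"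
  unfolding thy_def by blast+

lemma thy_weaken: "thy F \<Longrightarrow> \<turnstile> \<phi> \<^bold>\<longrightarrow> \<psi> \<Longrightarrow> \<phi> \<in> F \<Longrightarrow> \<psi> \<in> F"
  by (meson thy_derivable thy_MP)

text \<open>The set is the theory generated by \<open>F\<close> and \<open>\<chi>\<close>:
  \<open>PC1\<close> puts the theorems into it and \<open>PC2\<close> closes it under modus
  ponens.\<close>

lemma thy_Imp:
  assumes "thy F" shows "thy {\<theta>. (\<chi> \<^bold>\<longrightarrow> \<theta>) \<in> F}"
  unfolding thy_def
proof (intro conjI allI impI; simp only: mem_Collect_eq)
  fix \<phi> \<psi>
  show "(\<chi> \<^bold>\<longrightarrow> \<phi>) \<in> F" if "\<turnstile> \<phi>"
    using assms MP[OF PC1 that] by (rule thy_derivable)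
  show "(\<chi> \<^bold>\<longrightarrow> \<psi>) \<in> F" if "(\<chi> \<^bold>\<longrightarrow> (\<phi> \<^bold>\<longrightarrow> \<psi>)) \<in> F" "(\<chi> \<^bold>\<longrightarrow> \<phi>) \<in> F"
    using thy_MP[OF assms thy_weaken[OF assms PC2 that(1)] that(2)] .
qed

lemma Imp_refl: "\<turnstile> \<phi> \<^bold>\<longrightarrow> \<phi>"
  by (meson MP PC1 PC2)

text \<open>The deduction theorem. Quantifying over larger theories \<open>G\<close> replaces
  derivations from hypotheses, so that propositional arguments become membership arguments.\<close>

lemma deduction:
  assumes "thy F" and "\<And>G. thy G \<Longrightarrow> F \<subseteq> G \<Longrightarrow> \<chi> \<in> G \<Longrightarrow> \<theta> \<in> G"
  shows "(\<chi> \<^bold>\<longrightarrow> \<theta>) \<in> F"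
proof -
  have "\<theta> \<in> {\<theta>. (\<chi> \<^bold>\<longrightarrow> \<theta>) \<in> F}"
  proof (rule assms(2))
    show "F \<subseteq> {\<theta>. (\<chi> \<^bold>\<longrightarrow> \<theta>) \<in> F}"
      using assms(1) PC1 thy_weaken by blast
  qed (use assms(1) in \<open>auto intro: thy_Imp thy_derivable Imp_refl\<close>)
  then show ?thesis by simp
qed

lemma thy_derivables: "thy {\<phi>. \<turnstile> \<phi>}"
  unfolding thy_def using MP by auto

lemma ex_falso: "thy F \<Longrightarrow> \<phi> \<in> F \<Longrightarrow> \<^bold>\<not> \<phi> \<in> F \<Longrightarrow> \<psi> \<in> F"
  by (meson PC1 PC3 thy_MP thy_weaken)

text \<open>The arbitrary \<open>\<psi>\<close> in the premise expresses that \<open>G\<close> is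
  inconsistent without a designated falsum.\<close>

lemma by_contradiction:
  assumes F: "thy F" and "\<And>G \<psi>. thy G \<Longrightarrow> F \<subseteq> G \<Longrightarrow> \<^bold>\<not> \<phi> \<in> G \<Longrightarrow> \<psi> \<in> G"
  shows "\<phi> \<in> F"
proof -
  \<comment> \<open>The refuted formula is the theorem that \<open>\<phi>\<close> implies itself;
    \<open>PC3\<close> contraposes the implication, and \<open>\<phi>\<close> follows by modus
    ponens.\<close>
  have "(\<^bold>\<not> \<phi> \<^bold>\<longrightarrow> \<^bold>\<not> (\<phi> \<^bold>\<longrightarrow> \<phi>)) \<in> F"
    using F assms(2) by (rule deduction)
  then show ?thesis
    using F Imp_refl PC3 thy_MP thy_weaken thy_derivable by metis
qed

lemma thy_And: "thy F \<Longrightarrow> \<phi> \<^bold>\<and> \<psi> \<in> F \<longleftrightarrow> \<phi> \<in> F \<and> \<psi> \<in> F"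
  by (meson PC4 PC5 PC6 thy_MP thy_weaken)

lemma thy_Neg_Neg:
  assumes "thy F" "\<^bold>\<not> \<^bold>\<not> \<phi> \<in> F" shows "\<phi> \<in> F"
  using assms by (auto intro: by_contradiction ex_falso)

lemma refutation:
  assumes F: "thy F" and "\<And>G \<psi>. thy G \<Longrightarrow> F \<subseteq> G \<Longrightarrow> \<phi> \<in> G \<Longrightarrow> \<psi> \<in> G"
  shows "\<^bold>\<not> \<phi> \<in> F"
  using F assms(2) thy_Neg_Neg by (metis by_contradiction)

lemma modus_tollens:
  assumes "thy F" "(\<phi> \<^bold>\<longrightarrow> \<psi>) \<in> F" "\<^bold>\<not> \<psi> \<in> F" shows "\<^bold>\<not> \<phi> \<in> F"
proof (rule refutation[OF assms(1)])
  fix G \<chi> assume G: "thy G" "F \<subseteq> G" "\<phi> \<in> G"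
  then have "\<psi> \<in> G" using assms(2) thy_MP by blast
  then show "\<chi> \<in> G" using G assms(3) ex_falso by blast
qed

section \<open>Maximal consistent sets by Zorn's lemma\<close>

definition mcs :: "'v form set \<Rightarrow> bool" where
  "mcs M \<longleftrightarrow> thy M \<and> (\<forall>\<phi>. \<^bold>\<not> \<phi> \<in> M \<longleftrightarrow> \<phi> \<notin> M)"

lemma mcs_thy: "mcs M \<Longrightarrow> thy M"
  and mcs_Neg [simp]: "mcs M \<Longrightarrow> \<^bold>\<not> \<phi> \<in> M \<longleftrightarrow> \<phi> \<notin> M"
  unfolding mcs_def by blast+

lemma mcs_And [simp]: "mcs M \<Longrightarrow> \<phi> \<^bold>\<and> \<psi> \<in> M \<longleftrightarrow> \<phi> \<in> M \<and> \<psi> \<in> M"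
  by (simp add: mcs_thy thy_And)

lemma mcs_derivable: "mcs M \<Longrightarrow> \<turnstile> \<phi> \<Longrightarrow> \<phi> \<in> M"
  by (simp add: mcs_thy thy_derivable)

text \<open>Lindenbaum's lemma relative to a bound \<open>P\<close>: Zorn's lemma yields a theory
  maximal among those between \<open>F\<close> and \<open>P\<close>, and since \<open>P\<close> is
  prime for disjunction, this theory decides every formula. The bound lets one lemma serve both
  derivability and \<open>Star\<close>.\<close>

lemma extension:
  assumes F: "thy F" "F \<subseteq> P" and Bot: "Bot \<notin> P"
    and Or: "\<And>\<phi> \<psi>. (\<phi> \<^bold>\<or> \<psi>) \<in> P \<Longrightarrow> \<phi> \<in> P \<or> \<psi> \<in> P"
  obtains M where "mcs M" "F \<subseteq> M" "M \<subseteq> P"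
proof -
  let ?A = "{G. thy G \<and> F \<subseteq> G \<and> G \<subseteq> P}"
  have "\<exists>M\<in>?A. \<forall>G\<in>?A. M \<subseteq> G \<longrightarrow> G = M"
  proof (rule subset_Zorn_nonempty)
    show "?A \<noteq> {}" using F by blast
  next
    fix C assume "C \<noteq> {}" "subset.chain ?A C"
    then have C: "C \<noteq> {}" "\<And>G. G \<in> C \<Longrightarrow> thy G \<and> F \<subseteq> G \<and> G \<subseteq> P"
        "\<And>G H. G \<in> C \<Longrightarrow> H \<in> C \<Longrightarrow> G \<subseteq> H \<or> H \<subseteq> G"
      by (auto simp: subset_chain_def)
    have "thy (\<Union>C)" unfolding thy_def
    proof (intro conjI allI impI)
      fix \<phi> :: "'a form" assume "\<turnstile> \<phi>"
      then show "\<phi> \<in> \<Union>C" using C(1,2) thy_derivable by blast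
    next
      fix \<phi> \<psi> assume "(\<phi> \<^bold>\<longrightarrow> \<psi>) \<in> \<Union>C" "\<phi> \<in> \<Union>C"
      then obtain G H where GH: "G \<in> C" "H \<in> C" "(\<phi> \<^bold>\<longrightarrow> \<psi>) \<in> G" "\<phi> \<in> H" by blast
      then have "G \<subseteq> H \<or> H \<subseteq> G" "thy G" "thy H" using C(2,3) by blast+
      then show "\<psi> \<in> \<Union>C" using GH thy_MP by blast
    qed
    then show "\<Union>C \<in> ?A" using C(1,2) by blast
  qed
  then obtain M where M': "M \<in> ?A" "\<forall>G\<in>?A. M \<subseteq> G \<longrightarrow> G = M" ..
  from M'(1) have M: "thy M" "F \<subseteq> M" "M \<subseteq> P" by simp_all
  from M'(2) have max: "G = M" if "thy G" "F \<subseteq> G" "G \<subseteq> P" "M \<subseteq> G" for G using that by simp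
  \<comment> \<open>Adding \<open>\<chi>\<close> generates a theory larger than \<open>M\<close>, so
    by maximality it must leave \<open>P\<close>.\<close>
  have ext: "\<exists>\<theta>. (\<chi> \<^bold>\<longrightarrow> \<theta>) \<in> M \<and> \<theta> \<notin> P" if "\<chi> \<notin> M" for \<chi>
  proof (rule ccontr)
    let ?G = "{\<theta>. (\<chi> \<^bold>\<longrightarrow> \<theta>) \<in> M}"
    assume "\<not> ?thesis"
    then have "?G \<subseteq> P" by blast
    moreover have "M \<subseteq> ?G" using thy_weaken[OF M(1) PC1] by blast
    ultimately have "?G = M" using max[OF thy_Imp[OF M(1)]] M(2) by blast
    moreover have "\<chi> \<in> ?G" using thy_derivable[OF M(1) Imp_refl] by blast
    ultimately show False using that by blast
  qed
  have "\<chi> \<in> M \<or> \<^bold>\<not> \<chi> \<in> M" for \<chi>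
  proof (rule ccontr)
    assume "\<not> ?thesis"
    then obtain \<theta>1 \<theta>2 where \<theta>: "(\<chi> \<^bold>\<longrightarrow> \<theta>1) \<in> M" "(\<^bold>\<not> \<chi> \<^bold>\<longrightarrow> \<theta>2) \<in> M" "\<theta>1 \<notin> P" "\<theta>2 \<notin> P"
      using ext[of \<chi>] ext[of "\<^bold>\<not> \<chi>"] by blast
    \<comment> \<open>Excluded middle for \<open>\<chi>\<close> yields the disjunction in
      \<open>M\<close>, and primality of \<open>P\<close> would put one of the disjuncts into
      \<open>P\<close>.\<close>
    have "(\<theta>1 \<^bold>\<or> \<theta>2) \<in> M"
    proof (rule refutation[OF M(1)])
      fix G \<psi> assume G: "thy G" "M \<subseteq> G" "\<^bold>\<not> \<theta>1 \<^bold>\<and> \<^bold>\<not> \<theta>2 \<in> G"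
      then have n: "\<^bold>\<not> \<theta>1 \<in> G" "\<^bold>\<not> \<theta>2 \<in> G" by (auto simp: thy_And)
      have "\<^bold>\<not> \<chi> \<in> G" using modus_tollens[OF G(1) _ n(1)] G(2) \<theta>(1) by blast
      then have "\<theta>2 \<in> G" using thy_MP[OF G(1)] G(2) \<theta>(2) by blast
      then show "\<psi> \<in> G" using ex_falso[OF G(1)] n(2) by blast
    qed
    then show False using \<theta> M(3) Or by blast
  qed
  \<comment> \<open>Otherwise \<open>M\<close> would contain \<open>Bot\<close>, which lies outside
    \<open>P\<close>.\<close>
  moreover have "\<not> (\<chi> \<in> M \<and> \<^bold>\<not> \<chi> \<in> M)" for \<chi>
    using ex_falso M Bot by blast
  ultimately have "mcs M" using M unfolding mcs_def by blast
  then show thesis using M that by blast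
qed

lemma thy_principal: "thy {\<theta>. \<turnstile> \<phi> \<^bold>\<longrightarrow> \<theta>}"
  using thy_Imp[OF thy_derivables] by simp

text \<open>If \<open>\<phi>\<close> is not derivable, the consequences of its negation extend to a
  maximal consistent set whose members do not imply \<open>\<phi>\<close>; such a set omits
  \<open>\<phi>\<close>.\<close>

lemma derivable_if_all_mcs:
  assumes "\<And>M. mcs M \<Longrightarrow> \<phi> \<in> M" shows "\<turnstile> \<phi>"
proof (rule ccontr)
  assume n: "\<not> \<turnstile> \<phi>"
  let ?F = "{\<theta>. \<turnstile> \<^bold>\<not> \<phi> \<^bold>\<longrightarrow> \<theta>}"
  let ?P = "{\<theta>. \<not> (\<turnstile> \<theta> \<^bold>\<longrightarrow> \<phi>)}"
  have P: "\<phi> \<notin> ?P" using Imp_refl by blast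
  obtain M where "mcs M" "?F \<subseteq> M" "M \<subseteq> ?P"
  proof (rule extension[of ?F ?P])
    show "?F \<subseteq> ?P"
    proof clarify
      fix \<theta> assume \<theta>: "\<turnstile> \<^bold>\<not> \<phi> \<^bold>\<longrightarrow> \<theta>" "\<turnstile> \<theta> \<^bold>\<longrightarrow> \<phi>"
      have "\<phi> \<in> {\<phi>. \<turnstile> \<phi>}"
        by (rule by_contradiction[OF thy_derivables]) (meson \<theta> ex_falso thy_weaken)
      then show False using n by simp
    qed
    have "(Bot \<^bold>\<longrightarrow> \<phi>) \<in> {\<phi>. \<turnstile> \<phi>}"
      by (rule deduction[OF thy_derivables]) (meson Ax1 ex_falso thy_derivable)
    then show "Bot \<notin> ?P" by simp
    fix \<theta>1 \<theta>2 assume "(\<theta>1 \<^bold>\<or> \<theta>2) \<in> ?P"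
    moreover have "((\<theta>1 \<^bold>\<or> \<theta>2) \<^bold>\<longrightarrow> \<phi>) \<in> {\<phi>. \<turnstile> \<phi>}" if "\<turnstile> \<theta>1 \<^bold>\<longrightarrow> \<phi>" "\<turnstile> \<theta>2 \<^bold>\<longrightarrow> \<phi>"
    proof (rule deduction[OF thy_derivables], rule by_contradiction)
      fix G H \<psi> assume G: "thy G" "(\<theta>1 \<^bold>\<or> \<theta>2) \<in> G" "thy H" "G \<subseteq> H" "\<^bold>\<not> \<phi> \<in> H"
      have "\<^bold>\<not> \<theta>1 \<in> H" "\<^bold>\<not> \<theta>2 \<in> H"
        using modus_tollens[OF G(3) thy_derivable[OF G(3)] G(5)] that by blast+
      then have "\<^bold>\<not> \<theta>1 \<^bold>\<and> \<^bold>\<not> \<theta>2 \<in> H" using G(3) by (simp add: thy_And)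
      then show "\<psi> \<in> H" using ex_falso[OF G(3)] G(2,4) by blast
    qed
    ultimately show "\<theta>1 \<in> ?P \<or> \<theta>2 \<in> ?P" by auto
  qed (use thy_principal in auto)
  then show False using assms P by blast
qed

section \<open>Joins of maximal consistent sets\<close>

definition joins :: "'v form set \<Rightarrow> 'v form set \<Rightarrow> 'v form set \<Rightarrow> bool" where
  "joins \<Gamma> \<Gamma>1 \<Gamma>2 \<longleftrightarrow> mcs \<Gamma> \<and> mcs \<Gamma>1 \<and> mcs \<Gamma>2 \<and> (\<forall>\<phi>\<in>\<Gamma>1. \<forall>\<psi>\<in>\<Gamma>2. \<phi> \<^bold>* \<psi> \<in> \<Gamma>)"

lemma joins_mcs: "joins \<Gamma> \<Gamma>1 \<Gamma>2 \<Longrightarrow> mcs \<Gamma> \<and> mcs \<Gamma>1 \<and> mcs \<Gamma>2"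
  and joins_Star: "joins \<Gamma> \<Gamma>1 \<Gamma>2 \<Longrightarrow> \<phi> \<in> \<Gamma>1 \<Longrightarrow> \<psi> \<in> \<Gamma>2 \<Longrightarrow> \<phi> \<^bold>* \<psi> \<in> \<Gamma>"
  unfolding joins_def by blast+

lemma mcs_Imp: "mcs M \<Longrightarrow> \<turnstile> \<phi> \<^bold>\<longrightarrow> \<psi> \<Longrightarrow> \<phi> \<in> M \<Longrightarrow> \<psi> \<in> M"
  by (meson mcs_thy thy_weaken)

lemma mcs_Iff: "mcs M \<Longrightarrow> \<turnstile> \<phi> \<^bold>\<longleftrightarrow> \<psi> \<Longrightarrow> \<phi> \<in> M \<longleftrightarrow> \<psi> \<in> M"
  by (meson mcs_Imp MP PC4 PC5)

lemma mcs_Star_comm: "mcs M \<Longrightarrow> \<phi> \<^bold>* \<psi> \<in> M \<Longrightarrow> \<psi> \<^bold>* \<phi> \<in> M"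
  using mcs_Iff Ax7 by blast

lemma mcs_Star_mono:
  "mcs M \<Longrightarrow> \<turnstile> \<phi> \<^bold>\<longrightarrow> \<phi>' \<Longrightarrow> \<turnstile> \<psi> \<^bold>\<longrightarrow> \<psi>' \<Longrightarrow> \<phi> \<^bold>* \<psi> \<in> M \<Longrightarrow> \<phi>' \<^bold>* \<psi>' \<in> M"
  by (meson mcs_Imp StarMono mcs_Star_comm)

lemma mcs_Top [simp]: "mcs M \<Longrightarrow> undefined \<^bold>= undefined \<in> M"
  by (simp add: Ax1 mcs_derivable)

lemma mcs_Bot_Star: "mcs M \<Longrightarrow> Bot \<^bold>* \<phi> \<notin> M"
  using mcs_Iff[OF _ Ax10] by fastforce

lemma joins_comm: "joins \<Gamma> \<Gamma>1 \<Gamma>2 \<Longrightarrow> joins \<Gamma> \<Gamma>2 \<Gamma>1"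
  unfolding joins_def by (blast intro: mcs_Star_comm)

text \<open>Because \<open>Star\<close> distributes over disjunction (\<open>Ax9\<close>) and
  annihilates \<open>Bot\<close> (\<open>Ax10\<close>), the formulae compatible with all of
  \<open>T\<close> form a prime bound for \<open>extension\<close>.\<close>

lemma extension_left:
  assumes M: "mcs M" and F: "thy F" and T: "thy T"
    and FT: "\<And>\<phi> \<psi>. \<phi> \<in> F \<Longrightarrow> \<psi> \<in> T \<Longrightarrow> \<phi> \<^bold>* \<psi> \<in> M"
  obtains N where "mcs N" "F \<subseteq> N" "\<And>\<phi> \<psi>. \<phi> \<in> N \<Longrightarrow> \<psi> \<in> T \<Longrightarrow> \<phi> \<^bold>* \<psi> \<in> M"
proof (rule extension[of F "{\<phi>. \<forall>\<psi>\<in>T. \<phi> \<^bold>* \<psi> \<in> M}"])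
  show "Bot \<notin> {\<phi>. \<forall>\<psi>\<in>T. \<phi> \<^bold>* \<psi> \<in> M}"
    using M T mcs_Bot_Star thy_derivable[OF T Ax1] by blast
  fix \<phi>1 \<phi>2 assume or: "(\<phi>1 \<^bold>\<or> \<phi>2) \<in> {\<phi>. \<forall>\<psi>\<in>T. \<phi> \<^bold>* \<psi> \<in> M}"
  show "\<phi>1 \<in> {\<phi>. \<forall>\<psi>\<in>T. \<phi> \<^bold>* \<psi> \<in> M} \<or> \<phi>2 \<in> {\<phi>. \<forall>\<psi>\<in>T. \<phi> \<^bold>* \<psi> \<in> M}"
  proof (rule ccontr)
    assume "\<not> ?thesis"
    then obtain \<psi>1 \<psi>2 where \<psi>: "\<psi>1 \<in> T" "\<psi>2 \<in> T" "\<phi>1 \<^bold>* \<psi>1 \<notin> M" "\<phi>2 \<^bold>* \<psi>2 \<notin> M" by blast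
    \<comment> \<open>Conjoining the two witnesses stays inside the theory \<open>T\<close>;
      monotonicity of \<open>Star\<close> recovers each of them afterwards.\<close>
    then have "\<psi>1 \<^bold>\<and> \<psi>2 \<in> T" using T by (simp add: thy_And)
    then have "(\<phi>1 \<^bold>\<or> \<phi>2) \<^bold>* (\<psi>1 \<^bold>\<and> \<psi>2) \<in> M" using or by blast
    then have "((\<phi>1 \<^bold>* (\<psi>1 \<^bold>\<and> \<psi>2)) \<^bold>\<or> (\<phi>2 \<^bold>* (\<psi>1 \<^bold>\<and> \<psi>2))) \<in> M" using M Ax9 mcs_Imp by blast
    then have "\<phi>1 \<^bold>* (\<psi>1 \<^bold>\<and> \<psi>2) \<in> M \<or> \<phi>2 \<^bold>* (\<psi>1 \<^bold>\<and> \<psi>2) \<in> M" using M by auto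
    then show False using \<psi> mcs_Star_mono[OF M Imp_refl PC4] mcs_Star_mono[OF M Imp_refl PC5] by blast
  qed
qed (use F FT that in blast)+

text \<open>The left factor is completed first, against \<open>T\<close>; then the right one is
  completed against the finished left factor.\<close>

lemma joins_extension:
  assumes M: "mcs M" and F: "thy F" and T: "thy T"
    and FT: "\<And>\<phi> \<psi>. \<phi> \<in> F \<Longrightarrow> \<psi> \<in> T \<Longrightarrow> \<phi> \<^bold>* \<psi> \<in> M"
  obtains \<Gamma>1 \<Gamma>2 where "joins M \<Gamma>1 \<Gamma>2" "F \<subseteq> \<Gamma>1" "T \<subseteq> \<Gamma>2"
proof -
  obtain \<Gamma>1 where 1: "mcs \<Gamma>1" "F \<subseteq> \<Gamma>1" "\<And>\<phi> \<psi>. \<phi> \<in> \<Gamma>1 \<Longrightarrow> \<psi> \<in> T \<Longrightarrow> \<phi> \<^bold>* \<psi> \<in> M"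
    using extension_left[OF M F T FT] by metis
  obtain \<Gamma>2 where 2: "mcs \<Gamma>2" "T \<subseteq> \<Gamma>2" "\<And>\<phi> \<psi>. \<phi> \<in> \<Gamma>2 \<Longrightarrow> \<psi> \<in> \<Gamma>1 \<Longrightarrow> \<phi> \<^bold>* \<psi> \<in> M"
    using extension_left[OF M T mcs_thy[OF 1(1)]] 1(3) mcs_Star_comm[OF M] by metis
  have "joins M \<Gamma>1 \<Gamma>2" using M 1 2 mcs_Star_comm unfolding joins_def by blast
  then show thesis using that 1 2 by blast
qed

text \<open>The existence lemma of the canonical model: the consequences of \<open>\<phi>\<close>
  and those of \<open>\<psi>\<close> are theories whose products lie in \<open>M\<close> by
  monotonicity of \<open>Star\<close>.\<close>

lemma StarE:
  assumes M: "mcs M" and "\<phi> \<^bold>* \<psi> \<in> M"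
  obtains \<Gamma>1 \<Gamma>2 where "joins M \<Gamma>1 \<Gamma>2" "\<phi> \<in> \<Gamma>1" "\<psi> \<in> \<Gamma>2"
proof (rule joins_extension[OF M thy_principal thy_principal])
  fix \<Gamma>1 \<Gamma>2
  assume "joins M \<Gamma>1 \<Gamma>2" "{\<theta>. \<turnstile> \<phi> \<^bold>\<longrightarrow> \<theta>} \<subseteq> \<Gamma>1" "{\<theta>. \<turnstile> \<psi> \<^bold>\<longrightarrow> \<theta>} \<subseteq> \<Gamma>2"
  then show thesis using that Imp_refl by blast
next
  show "\<phi>' \<^bold>* \<psi>' \<in> M" if "\<phi>' \<in> {\<theta>. \<turnstile> \<phi> \<^bold>\<longrightarrow> \<theta>}" "\<psi>' \<in> {\<theta>. \<turnstile> \<psi> \<^bold>\<longrightarrow> \<theta>}" for \<phi>' \<psi>'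
    using that assms by (auto intro: mcs_Star_mono)
qed

text \<open>\<open>E\<close> extends the theory of all consequences of products from
  \<open>\<Gamma>1\<close> and \<open>\<Gamma>2\<close>; \<open>Ax8\<close> makes that theory
  compatible with \<open>\<Gamma>3\<close>.\<close>

lemma joins_assoc:
  assumes 1: "joins \<Gamma> \<Gamma>1 \<Delta>" and 2: "joins \<Delta> \<Gamma>2 \<Gamma>3"
  obtains E where "joins \<Gamma> E \<Gamma>3" "joins E \<Gamma>1 \<Gamma>2"
proof -
  note m = joins_mcs[OF 1] joins_mcs[OF 2]
  let ?F = "{\<theta>. \<exists>\<phi>\<in>\<Gamma>1. \<exists>\<psi>\<in>\<Gamma>2. \<turnstile> \<phi> \<^bold>* \<psi> \<^bold>\<longrightarrow> \<theta>}"
  have "thy ?F" unfolding thy_def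
  proof (intro conjI allI impI)
    fix \<theta> :: "'a form" assume "\<turnstile> \<theta>"
    then have "\<turnstile> Top \<^bold>* Top \<^bold>\<longrightarrow> \<theta>" using PC1 MP by blast
    moreover have "Top \<in> \<Gamma>1" "Top \<in> \<Gamma>2" using m by simp_all
    ultimately show "\<theta> \<in> ?F" by blast
  next
    fix \<theta> \<chi> assume "(\<theta> \<^bold>\<longrightarrow> \<chi>) \<in> ?F" "\<theta> \<in> ?F"
    then obtain a b c d where *: "a \<in> \<Gamma>1" "b \<in> \<Gamma>2" "c \<in> \<Gamma>1" "d \<in> \<Gamma>2"
      "\<turnstile> a \<^bold>* b \<^bold>\<longrightarrow> (\<theta> \<^bold>\<longrightarrow> \<chi>)" "\<turnstile> c \<^bold>* d \<^bold>\<longrightarrow> \<theta>" by blast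
    \<comment> \<open>Conjoining componentwise gives a single product that implies both given
      ones.\<close>
    have "\<turnstile> (a \<^bold>\<and> c) \<^bold>* (b \<^bold>\<and> d) \<^bold>\<longrightarrow> \<chi>"
    proof (rule derivable_if_all_mcs)
      fix M :: "'a form set" assume M: "mcs M"
      show "((a \<^bold>\<and> c) \<^bold>* (b \<^bold>\<and> d) \<^bold>\<longrightarrow> \<chi>) \<in> M"
      proof (cases "(a \<^bold>\<and> c) \<^bold>* (b \<^bold>\<and> d) \<in> M")
        case True
        then have "a \<^bold>* b \<in> M" "c \<^bold>* d \<in> M" using M mcs_Star_mono PC4 PC5 by blast+
        then show ?thesis using M *(5,6) mcs_Imp mcs_thy thy_MP by (metis mcs_And mcs_Neg)
      qed (use M in simp)
    qed
    moreover have "a \<^bold>\<and> c \<in> \<Gamma>1" "b \<^bold>\<and> d \<in> \<Gamma>2" using * m by auto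
    ultimately show "\<chi> \<in> ?F" by blast
  qed
  then obtain E G3 where E: "joins \<Gamma> E G3" "?F \<subseteq> E" "\<Gamma>3 \<subseteq> G3"
  proof (rule joins_extension[rotated, where T = \<Gamma>3])
    fix \<theta> \<chi> assume "\<theta> \<in> ?F" "\<chi> \<in> \<Gamma>3"
    then obtain \<phi> \<psi> where *: "\<phi> \<in> \<Gamma>1" "\<psi> \<in> \<Gamma>2" "\<turnstile> \<phi> \<^bold>* \<psi> \<^bold>\<longrightarrow> \<theta>" by blast
    then have "\<phi> \<^bold>* (\<psi> \<^bold>* \<chi>) \<in> \<Gamma>" using 1 2 \<open>\<chi> \<in> \<Gamma>3\<close> by (simp add: joins_Star)
    then have "(\<phi> \<^bold>* \<psi>) \<^bold>* \<chi> \<in> \<Gamma>" using m mcs_Iff[OF _ Ax8] by blast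
    then show "\<theta> \<^bold>* \<chi> \<in> \<Gamma>" using m * mcs_Star_mono Imp_refl by blast
  qed (use m mcs_thy in auto)
  \<comment> \<open>A maximal consistent set has no proper extension of the same kind.\<close>
  have "G3 = \<Gamma>3" using m E(3) joins_mcs[OF E(1)] mcs_Neg by blast
  moreover have "joins E \<Gamma>1 \<Gamma>2"
    using E(1,2) m joins_mcs Imp_refl unfolding joins_def by blast
  ultimately show thesis using E that by blast
qed

lemma joins_exchange:
  assumes "joins \<Gamma> \<Gamma>1 \<Delta>" "joins \<Delta> \<Gamma>2 \<Gamma>3"
  obtains E where "joins \<Gamma> \<Gamma>2 E" "joins E \<Gamma>1 \<Gamma>3"
proof -
  obtain E where "joins \<Gamma> E \<Gamma>2" "joins E \<Gamma>1 \<Gamma>3"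
    using joins_assoc[OF assms(1) joins_comm[OF assms(2)]] .
  then show thesis using that joins_comm by blast
qed


section \<open>Core formulae along joins\<close>

lemma joins_Imp:
  assumes j: "joins \<Gamma> \<Gamma>1 \<Gamma>2" and ax: "\<turnstile> \<phi> \<^bold>* \<psi> \<^bold>\<longrightarrow> \<chi>" and "\<phi> \<in> \<Gamma>1" "\<psi> \<in> \<Gamma>2"
  shows "\<chi> \<in> \<Gamma>"
  using mcs_Imp[OF conjunct1[OF joins_mcs[OF j]] ax joins_Star[OF j assms(3,4)]] .

lemma joins_mono_left:
  assumes j: "joins \<Gamma> \<Gamma>1 \<Gamma>2" and ax: "\<turnstile> \<xi> \<^bold>* Top \<^bold>\<longrightarrow> \<xi>" and "\<xi> \<in> \<Gamma>1"
  shows "\<xi> \<in> \<Gamma>"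
  using joins_Imp[OF j ax assms(3)] joins_mcs[OF j] by simp

text \<open>Equalities do not depend on the heap: \<open>Ax14\<close> transports both an equation
  and its negation from a component to the whole, which gives both directions.\<close>

lemma joins_Eq:
  assumes j: "joins \<Gamma> \<Gamma>1 \<Gamma>2"
  shows "x \<^bold>= y \<in> \<Gamma>1 \<longleftrightarrow> x \<^bold>= y \<in> \<Gamma>" "x \<^bold>= y \<in> \<Gamma>2 \<longleftrightarrow> x \<^bold>= y \<in> \<Gamma>"
proof -
  have *: "x \<^bold>= y \<in> A \<longleftrightarrow> x \<^bold>= y \<in> \<Gamma>" if "joins \<Gamma> A B" for A B
  proof -
    have "\<turnstile> x \<^bold>= y \<^bold>* Top \<^bold>\<longrightarrow> x \<^bold>= y" "\<turnstile> \<^bold>\<not> x \<^bold>= y \<^bold>* Top \<^bold>\<longrightarrow> \<^bold>\<not> x \<^bold>= y"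
      by (rule Ax14[of _ x y], simp)+
    then show ?thesis using joins_mono_left[OF that] joins_mcs[OF that] mcs_Neg by metis
  qed
  show "x \<^bold>= y \<in> \<Gamma>1 \<longleftrightarrow> x \<^bold>= y \<in> \<Gamma>" "x \<^bold>= y \<in> \<Gamma>2 \<longleftrightarrow> x \<^bold>= y \<in> \<Gamma>"
    using * j joins_comm by blast+
qed

lemma joins_Alloc_disjoint:
  assumes j: "joins \<Gamma> \<Gamma>1 \<Gamma>2" shows "\<not> (Alloc x \<in> \<Gamma>1 \<and> Alloc x \<in> \<Gamma>2)"
proof
  assume "Alloc x \<in> \<Gamma>1 \<and> Alloc x \<in> \<Gamma>2"
  then have "Bot \<in> \<Gamma>" using joins_Imp[OF j MP[OF PC4 Ax13]] by blast
  then show False using joins_mcs[OF j] by simp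
qed

text \<open>\<open>Ax12\<close> carries \<open>Alloc\<close> from a component to the whole, and
  \<open>Ax15\<close> carries its failure in both components to the whole.\<close>

lemma joins_Alloc:
  assumes j: "joins \<Gamma> \<Gamma>1 \<Gamma>2" shows "Alloc x \<in> \<Gamma> \<longleftrightarrow> Alloc x \<in> \<Gamma>1 \<or> Alloc x \<in> \<Gamma>2"
proof
  note m = joins_mcs[OF j]
  assume "Alloc x \<in> \<Gamma>"
  show "Alloc x \<in> \<Gamma>1 \<or> Alloc x \<in> \<Gamma>2"
  proof (rule ccontr)
    assume "\<not> ?thesis"
    then have "\<^bold>\<not> Alloc x \<in> \<Gamma>1" "\<^bold>\<not> Alloc x \<in> \<Gamma>2" using m by auto
    then have "\<^bold>\<not> Alloc x \<in> \<Gamma>" by (rule joins_Imp[OF j Ax15])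
    then show False using m \<open>Alloc x \<in> \<Gamma>\<close> by simp
  qed
qed (use joins_mono_left[OF j Ax12] joins_mono_left[OF joins_comm[OF j] Ax12] in blast)

lemma mcs_Pto_Alloc: "mcs \<Gamma> \<Longrightarrow> x \<hookrightarrow> y \<in> \<Gamma> \<Longrightarrow> Alloc x \<in> \<Gamma>"
  by (rule mcs_Imp[OF _ Ax3])

text \<open>\<open>Ax14\<close> carries a points-to upwards; by \<open>Ax16\<close> its failure at
  an allocated variable is carried upwards too.\<close>

lemma joins_Pto_left:
  assumes j: "joins \<Gamma> \<Gamma>1 \<Gamma>2" and a: "Alloc x \<in> \<Gamma>1" shows "x \<hookrightarrow> y \<in> \<Gamma>1 \<longleftrightarrow> x \<hookrightarrow> y \<in> \<Gamma>"
proof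
  note m = joins_mcs[OF j]
  have "\<turnstile> x \<hookrightarrow> y \<^bold>* Top \<^bold>\<longrightarrow> x \<hookrightarrow> y" by (rule Ax14[of _ x y]) simp
  then show "x \<hookrightarrow> y \<in> \<Gamma>" if "x \<hookrightarrow> y \<in> \<Gamma>1" using joins_mono_left[OF j] that by blast
  assume p: "x \<hookrightarrow> y \<in> \<Gamma>"
  show "x \<hookrightarrow> y \<in> \<Gamma>1"
  proof (rule ccontr)
    assume "x \<hookrightarrow> y \<notin> \<Gamma>1"
    then have "Alloc x \<^bold>\<and> \<^bold>\<not> x \<hookrightarrow> y \<in> \<Gamma>1" "Top \<in> \<Gamma>2" using m a by simp_all
    then have "\<^bold>\<not> x \<hookrightarrow> y \<in> \<Gamma>" by (rule joins_Imp[OF j Ax16])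
    then show False using m p by simp
  qed
qed

lemma joins_Pto:
  assumes j: "joins \<Gamma> \<Gamma>1 \<Gamma>2" shows "x \<hookrightarrow> y \<in> \<Gamma>1 \<longleftrightarrow> x \<hookrightarrow> y \<in> \<Gamma> \<and> Alloc x \<in> \<Gamma>1"
  using joins_Pto_left[OF j, of x y] mcs_Pto_Alloc[of \<Gamma>1 x y] joins_mcs[OF j] by blast

section \<open>Size along joins\<close>

lemma joins_Emp:
  assumes "mcs \<Gamma>" obtains \<Gamma>1 \<Gamma>2 where "joins \<Gamma> \<Gamma>1 \<Gamma>2" "Emp \<in> \<Gamma>1"
proof -
  have "Top \<in> \<Gamma>" using assms by simp
  then have "Top \<^bold>* Emp \<in> \<Gamma>" by (rule iffD1[OF mcs_Iff[OF assms Ax11]])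
  then obtain A B where "joins \<Gamma> A B" "Emp \<in> B" by (rule StarE[OF assms])
  then show thesis using joins_comm that by blast
qed

text \<open>The nonempty part of \<open>\<Gamma>2\<close> is exchanged to the front, so that the
  induction hypothesis applies to \<open>\<Gamma>1\<close> joined with the remainder.\<close>

lemma joins_size_ge_right:
  "joins \<Gamma> \<Gamma>1 \<Gamma>2 \<Longrightarrow> size_ge n \<in> \<Gamma>2 \<Longrightarrow> size_ge n \<in> \<Gamma>"
proof (induction n arbitrary: \<Gamma> \<Gamma>1 \<Gamma>2 rule: size_ge.induct)
  case 1
  then show ?case using joins_mcs[OF 1(1)] by simp
next
  case 2
  have "\<turnstile> \<^bold>\<not> Emp \<^bold>* Top \<^bold>\<longrightarrow> \<^bold>\<not> Emp" by (rule Ax14[of _ undefined undefined]) simp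
  from joins_mono_left[OF joins_comm[OF 2(1)] this] 2(2) show ?case by simp
next
  case (3 n)
  obtain A B where AB: "joins \<Gamma>2 A B" "\<^bold>\<not> Emp \<in> A" "size_ge (Suc n) \<in> B"
    by (rule StarE[OF conjunct2[OF conjunct2[OF joins_mcs[OF "3.prems"(1)]]]
      "3.prems"(2)[unfolded size_ge.simps]])
  obtain E where E: "joins \<Gamma> A E" "joins E \<Gamma>1 B"
    by (rule joins_exchange[OF "3.prems"(1) AB(1)])
  then have "size_ge (Suc n) \<in> E" using "3.IH" AB(3) by blast
  then show ?case using joins_Star E(1) AB(2) unfolding size_ge.simps by blast
qed

lemma joins_size_ge_add:
  "joins \<Gamma> \<Gamma>1 \<Gamma>2 \<Longrightarrow> size_ge a \<in> \<Gamma>1 \<Longrightarrow> size_ge b \<in> \<Gamma>2 \<Longrightarrow> size_ge (a + b) \<in> \<Gamma>"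
proof (induction a arbitrary: \<Gamma> \<Gamma>1 \<Gamma>2 rule: size_ge.induct)
  case 1
  then show ?case using joins_size_ge_right[OF 1(1)] by simp
next
  case 2
  show ?case
  proof (cases b)
    case 0
    then show ?thesis using 2(2) joins_size_ge_right[OF joins_comm[OF 2(1)], of 1] by simp
  next
    case (Suc n)
    then show ?thesis using 2(2,3) joins_Star[OF 2(1)] by simp
  qed
next
  case (3 n)
  obtain A B where AB: "joins \<Gamma>1 A B" "\<^bold>\<not> Emp \<in> A" "size_ge (Suc n) \<in> B"
    by (rule StarE[OF conjunct1[OF conjunct2[OF joins_mcs[OF "3.prems"(1)]]]
      "3.prems"(2)[unfolded size_ge.simps]])
  obtain E where E: "joins \<Gamma> A E" "joins E \<Gamma>2 B"
    by (rule joins_exchange[OF joins_comm[OF "3.prems"(1)] AB(1)])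
  then have "size_ge (Suc n + b) \<in> E" using "3.IH" AB(3) "3.prems"(3) joins_comm by blast
  then show ?case using joins_Star[OF E(1) AB(2)] by simp
qed

text \<open>\<open>Ax19\<close> on maximal sets. The subtraction of one is exact: at most
  \<open>a - 1\<close> and at most \<open>b - 1\<close> cells make at most
  \<open>a + b - 2\<close>.\<close>

lemma joins_not_size_ge:
  assumes j: "joins \<Gamma> \<Gamma>1 \<Gamma>2" and "size_ge a \<notin> \<Gamma>1" "size_ge b \<notin> \<Gamma>2"
  shows "size_ge (a + b - 1) \<notin> \<Gamma>"
proof -
  note m = joins_mcs[OF j]
  have "\<^bold>\<not> size_ge a \<in> \<Gamma>1" "\<^bold>\<not> size_ge b \<in> \<Gamma>2" using assms m by simp_all
  then have "\<^bold>\<not> size_ge (a + b - 1) \<in> \<Gamma>" by (rule joins_Imp[OF j Ax19])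
  then show ?thesis using m by simp
qed

lemma size_ge_Suc: "mcs \<Gamma> \<Longrightarrow> size_ge (Suc n) \<in> \<Gamma> \<Longrightarrow> size_ge n \<in> \<Gamma>"
proof (cases n)
  case (Suc k)
  assume m: "mcs \<Gamma>" and "size_ge (Suc n) \<in> \<Gamma>"
  then have "\<^bold>\<not> Emp \<^bold>* size_ge n \<in> \<Gamma>" using Suc by simp
  then obtain A B where "joins \<Gamma> A B" "size_ge n \<in> B" by (rule StarE[OF m])
  then show ?thesis by (rule joins_size_ge_right)
qed auto

lemma size_ge_mono: "m \<le> n \<Longrightarrow> mcs \<Gamma> \<Longrightarrow> size_ge n \<in> \<Gamma> \<Longrightarrow> size_ge m \<in> \<Gamma>"
  by (induction rule: inc_induct) (use size_ge_Suc in blast)+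

text \<open>A maximal consistent set may contain \<open>size_ge \<beta>\<close> for every
  \<open>\<beta>\<close>, like an infinite heap. The predicate singles out the sets of finite size,
  which can be subtracted along a join.\<close>

definition exact_size :: "nat \<Rightarrow> 'v form set \<Rightarrow> bool" where
  "exact_size n \<Gamma> \<longleftrightarrow> (\<forall>\<beta>. size_ge \<beta> \<in> \<Gamma> \<longleftrightarrow> \<beta> \<le> n)"

lemma exact_sizeI: "mcs \<Gamma> \<Longrightarrow> size_ge n \<in> \<Gamma> \<Longrightarrow> size_ge (Suc n) \<notin> \<Gamma> \<Longrightarrow> exact_size n \<Gamma>"
  unfolding exact_size_def using size_ge_mono not_less_eq_eq by metis

lemma exact_size_1: "mcs \<Gamma> \<Longrightarrow> size_eq 1 \<in> \<Gamma> \<Longrightarrow> exact_size 1 \<Gamma>"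
  by (rule exact_sizeI) (simp_all add: size_eq_def)

lemma exact_size_0: "mcs \<Gamma> \<Longrightarrow> Emp \<in> \<Gamma> \<Longrightarrow> exact_size 0 \<Gamma>"
  by (rule exact_sizeI) simp_all

lemma joins_exact_size:
  assumes j: "joins \<Gamma> \<Gamma>1 \<Gamma>2" and 1: "exact_size a \<Gamma>1" and 2: "exact_size b \<Gamma>2"
  shows "exact_size (a + b) \<Gamma>"
  using joins_mcs[OF j] joins_size_ge_add[OF j, of a b] joins_not_size_ge[OF j, of "Suc a" "Suc b"] 1 2
  by (intro exact_sizeI) (auto simp: exact_size_def)

text \<open>A finite size cancels: one direction is additivity, the other is \<open>Ax19\<close> at
  \<open>Suc k\<close>, where the subtraction of one leaves \<open>k + \<beta>\<close>.\<close>

lemma joins_size_ge_diff: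
  assumes j: "joins \<Gamma> \<Gamma>1 \<Gamma>2" and 1: "exact_size k \<Gamma>1"
  shows "size_ge \<beta> \<in> \<Gamma>2 \<longleftrightarrow> size_ge (k + \<beta>) \<in> \<Gamma>"
  using joins_size_ge_add[OF j, of k \<beta>] joins_not_size_ge[OF j, of "Suc k" \<beta>] 1
  by (auto simp: exact_size_def)

section \<open>Splitting off cells\<close>

text \<open>\<open>Ax18\<close> supplies one cell at a time, and associativity gathers the cells
  into one component.\<close>

lemma split_anonymous:
  "mcs \<Gamma> \<Longrightarrow> size_ge r \<in> \<Gamma> \<Longrightarrow> \<exists>\<Gamma>1 \<Gamma>2. joins \<Gamma> \<Gamma>1 \<Gamma>2 \<and> exact_size r \<Gamma>1"
proof (induction r arbitrary: \<Gamma>)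
  case 0
  obtain A B where "joins \<Gamma> A B" "Emp \<in> A" by (rule joins_Emp[OF 0(1)])
  then show ?case using joins_mcs exact_size_0 by blast
next
  case (Suc r)
  have "\<^bold>\<not> Emp \<in> \<Gamma>" using size_ge_mono[of 1 "Suc r" \<Gamma>] Suc.prems by simp
  then have "size_eq 1 \<^bold>* Top \<in> \<Gamma>" by (rule mcs_Imp[OF Suc.prems(1) Ax18])
  then obtain A B where AB: "joins \<Gamma> A B" "size_eq 1 \<in> A" by (rule StarE[OF Suc.prems(1)])
  then have A: "exact_size 1 A" using exact_size_1 joins_mcs by blast
  have "size_ge r \<in> B" using joins_size_ge_diff[OF AB(1) A] Suc.prems(2) by simp
  then obtain C D where CD: "joins B C D" "exact_size r C" using Suc.IH joins_mcs AB(1) by blast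
  obtain E where E: "joins \<Gamma> E D" "joins E A C" by (rule joins_assoc[OF AB(1) CD(1)])
  then show ?case using joins_exact_size[OF E(2) A CD(2)] by auto
qed

text \<open>\<open>Ax17\<close> supplies the cell of one variable. By \<open>Ax20\<close> that cell
  cannot hold a second, different variable, so the others stay allocated in the remainder.\<close>

lemma split_named:
  assumes "finite Y"
  shows "mcs \<Gamma> \<Longrightarrow> (\<And>y. y \<in> Y \<Longrightarrow> Alloc y \<in> \<Gamma>) \<Longrightarrow> pairwise (\<lambda>x y. x \<^bold>= y \<notin> \<Gamma>) Y \<Longrightarrow>
    \<exists>\<Gamma>1 \<Gamma>2. joins \<Gamma> \<Gamma>1 \<Gamma>2 \<and> exact_size (card Y) \<Gamma>1 \<and> (\<forall>y\<in>Y. Alloc y \<in> \<Gamma>1)"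
  using assms
proof (induction Y arbitrary: \<Gamma> rule: finite_induct)
  case empty
  obtain A B where "joins \<Gamma> A B" "Emp \<in> A" by (rule joins_Emp[OF empty(1)])
  moreover have "exact_size 0 A" using calculation joins_mcs exact_size_0 by blast
  ultimately show ?case by auto
next
  case (insert y Y)
  have "(Alloc y \<^bold>\<and> size_eq 1) \<^bold>* Top \<in> \<Gamma>" 
    by (rule mcs_Imp[OF insert.prems(1) Ax17]) (simp add: insert.prems(2))
  then obtain A B where AB: "joins \<Gamma> A B" "Alloc y \<^bold>\<and> size_eq 1 \<in> A"
    by (rule StarE[OF insert.prems(1)])
  have mA: "mcs A" "mcs B" using joins_mcs[OF AB(1)] by auto
  then have A: "exact_size 1 A" "Alloc y \<in> A" using exact_size_1[OF mA(1)] AB(2) by simp_all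
  have "Alloc z \<in> B" if z: "z \<in> Y" for z
  proof -
    have "Alloc z \<notin> A"
    proof
      assume "Alloc z \<in> A"
      moreover have "y \<^bold>= z \<notin> A" using insert.prems(3) z insert.hyps(2) joins_Eq(1)[OF AB(1)]
        by (auto simp: pairwise_def)
      ultimately have "size_ge 2 \<in> A" using mA(1) mcs_Imp[OF mA(1) Ax20, of y z] A(2) by simp
      then show False using A(1) by (simp add: exact_size_def)
    qed
    then show ?thesis using joins_Alloc[OF AB(1)] insert.prems(2) z by blast
  qed
  moreover have "pairwise (\<lambda>x y. x \<^bold>= y \<notin> B) Y"
    using insert.prems(3) by (simp add: joins_Eq(2)[OF AB(1)] pairwise_insert)
  ultimately obtain C D where CD: "joins B C D" "exact_size (card Y) C" "\<forall>y\<in>Y. Alloc y \<in> C"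
    using insert.IH[OF mA(2)] by blast
  obtain E where E: "joins \<Gamma> E D" "joins E A C" by (rule joins_assoc[OF AB(1) CD(1)])
  have "exact_size (card (insert y Y)) E"
    using joins_exact_size[OF E(2) A(1) CD(2)] insert.hyps by simp
  moreover have "\<forall>z\<in>insert y Y. Alloc z \<in> E" using joins_Alloc[OF E(2)] A(2) CD(3) by blast
  ultimately show ?case using E(1) by blast
qed

lemma card_le_size_ge:
  assumes "finite Y" "mcs \<Gamma>" "\<And>y. y \<in> Y \<Longrightarrow> Alloc y \<in> \<Gamma>" "pairwise (\<lambda>x y. x \<^bold>= y \<notin> \<Gamma>) Y"
  shows "size_ge (card Y) \<in> \<Gamma>"
proof -
  obtain A B where "joins \<Gamma> A B" "exact_size (card Y) A"
    using split_named[OF assms] by blast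
  then show ?thesis using joins_size_ge_right joins_comm unfolding exact_size_def by blast
qed

text \<open>The cells named by \<open>Y1\<close> are split off first, then those named by
  \<open>Y2\<close>, then \<open>r\<close> anonymous ones; the anonymous cells are regrouped with
  \<open>Y1\<close>, and what is left goes to \<open>Y2\<close>.\<close>

lemma split_mcs:
  assumes m: "mcs \<Gamma>" and f: "finite Y1" "finite Y2" and d: "Y1 \<inter> Y2 = {}"
    and al: "\<And>y. y \<in> Y1 \<union> Y2 \<Longrightarrow> Alloc y \<in> \<Gamma>"
    and pw: "pairwise (\<lambda>x y. x \<^bold>= y \<notin> \<Gamma>) (Y1 \<union> Y2)"
    and sz: "size_ge (card Y1 + (card Y2 + r)) \<in> \<Gamma>"
  obtains \<Gamma>1 \<Gamma>2 where "joins \<Gamma> \<Gamma>1 \<Gamma>2" "exact_size (card Y1 + r) \<Gamma>1"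
    "\<And>y. y \<in> Y1 \<Longrightarrow> Alloc y \<in> \<Gamma>1" "\<And>y. y \<in> Y2 \<Longrightarrow> Alloc y \<in> \<Gamma>2"
proof -
  obtain A B where A: "joins \<Gamma> A B" "exact_size (card Y1) A" "\<forall>y\<in>Y1. Alloc y \<in> A"
    using split_named[OF f(1) m] al pairwise_subset[OF pw] by blast
  have mA: "mcs A" "mcs B" using joins_mcs[OF A(1)] by auto
  have eqA: "x \<^bold>= y \<in> A \<longleftrightarrow> x \<^bold>= y \<in> \<Gamma>" "x \<^bold>= y \<in> B \<longleftrightarrow> x \<^bold>= y \<in> \<Gamma>" for x y
    using joins_Eq[OF A(1)] by auto
  have "Alloc y \<in> B" if y: "y \<in> Y2" for y
  proof -
    \<comment> \<open>Otherwise \<open>A\<close> would hold one distinct named cell more than its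
      exact size \<open>card Y1\<close>.\<close>
    have "Alloc y \<notin> A"
    proof
      assume "Alloc y \<in> A"
      then have "\<And>z. z \<in> insert y Y1 \<Longrightarrow> Alloc z \<in> A" using A(3) by blast
      moreover have "pairwise (\<lambda>x y. x \<^bold>= y \<notin> A) (insert y Y1)"
        unfolding eqA by (rule pairwise_subset[OF pw]) (use y in blast)
      ultimately have "size_ge (card (insert y Y1)) \<in> A"
        using card_le_size_ge[OF _ mA(1)] f(1) by blast
      moreover have "card (insert y Y1) = Suc (card Y1)" using y d f by (subst card_insert_disjoint) auto
      ultimately show False using A(2) by (simp add: exact_size_def)
    qed
    then show ?thesis using joins_Alloc[OF A(1)] al y by blast
  qed
  moreover have "pairwise (\<lambda>x y. x \<^bold>= y \<notin> B) Y2" using pairwise_subset[OF pw] by (simp add: eqA)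
  ultimately obtain C D where C: "joins B C D" "exact_size (card Y2) C" "\<forall>y\<in>Y2. Alloc y \<in> C"
    using split_named[OF f(2) mA(2)] by blast
  have "size_ge r \<in> D"
    using sz joins_size_ge_diff[OF A(1,2)] joins_size_ge_diff[OF C(1,2)] by simp
  then obtain R Q where R: "joins D R Q" "exact_size r R"
    using split_anonymous joins_mcs[OF C(1)] by blast
  obtain E where E: "joins B R E" "joins E C Q" by (rule joins_exchange[OF C(1) R(1)])
  obtain F where F: "joins \<Gamma> F E" "joins F A R" by (rule joins_assoc[OF A(1) E(1)])
  show thesis
  proof (rule that[OF F(1)])
    show "exact_size (card Y1 + r) F" using joins_exact_size F(2) A(2) R(2) by blast
    show "Alloc y \<in> F" if "y \<in> Y1" for y using that joins_Alloc[OF F(2)] A(3) by blast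
    show "Alloc y \<in> E" if "y \<in> Y2" for y using that joins_Alloc[OF E(2)] C(3) by blast
  qed
qed

section \<open>Equality as a congruence\<close>

text \<open>\<open>Ax2\<close> gives one direction; applied to the negated formula it gives the
  other.\<close>

lemma map_form_iff:
  assumes m: "mcs \<Gamma>" and e: "x \<^bold>= y \<in> \<Gamma>"
  shows "map_form (\<lambda>z. if z = y then x else z) \<phi> \<in> \<Gamma> \<longleftrightarrow> \<phi> \<in> \<Gamma>"
proof -
  have *: "map_form (\<lambda>z. if z = y then x else z) \<psi> \<in> \<Gamma>" if "\<psi> \<in> \<Gamma>" for \<psi>
    using mcs_Imp[OF m Ax2] m e that by simp
  show ?thesis using *[of \<phi>] *[of "\<^bold>\<not> \<phi>"] m by auto
qed

lemma mcs_subst: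
  assumes "mcs \<Gamma>" "x \<^bold>= y \<in> \<Gamma>"
    and "map_form (\<lambda>z. if z = y then x else z) \<phi> = map_form (\<lambda>z. if z = y then x else z) \<psi>"
  shows "\<phi> \<in> \<Gamma> \<longleftrightarrow> \<psi> \<in> \<Gamma>"
  using map_form_iff[OF assms(1,2), of \<phi>] map_form_iff[OF assms(1,2), of \<psi>] assms(3) by simp

lemma mcs_Eq_refl: "mcs \<Gamma> \<Longrightarrow> x \<^bold>= x \<in> \<Gamma>"
  by (simp add: Ax1 mcs_derivable)

lemma mcs_Eq_cong: "mcs \<Gamma> \<Longrightarrow> x \<^bold>= y \<in> \<Gamma> \<Longrightarrow> x \<^bold>= z \<in> \<Gamma> \<longleftrightarrow> y \<^bold>= z \<in> \<Gamma>"
  by (rule mcs_subst[of \<Gamma> x y]) auto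

lemma mcs_Eq_sym: "mcs \<Gamma> \<Longrightarrow> x \<^bold>= y \<in> \<Gamma> \<Longrightarrow> y \<^bold>= x \<in> \<Gamma>"
  using mcs_Eq_cong[of \<Gamma> x y x] mcs_Eq_refl[of \<Gamma> x] by simp

lemma mcs_Alloc_cong: "mcs \<Gamma> \<Longrightarrow> x \<^bold>= y \<in> \<Gamma> \<Longrightarrow> Alloc x \<in> \<Gamma> \<longleftrightarrow> Alloc y \<in> \<Gamma>"
  by (rule mcs_subst[of \<Gamma> x y]) auto

lemma mcs_Pto_cong:
  assumes "mcs \<Gamma>" "x \<^bold>= x' \<in> \<Gamma>" "y \<^bold>= y' \<in> \<Gamma>"
  shows "x \<hookrightarrow> y \<in> \<Gamma> \<longleftrightarrow> x' \<hookrightarrow> y' \<in> \<Gamma>"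
proof -
  have "x \<hookrightarrow> y \<in> \<Gamma> \<longleftrightarrow> x' \<hookrightarrow> y \<in> \<Gamma>" using assms by (intro mcs_subst[of \<Gamma> x x']) auto
  also have "\<dots> \<longleftrightarrow> x' \<hookrightarrow> y' \<in> \<Gamma>" using assms by (intro mcs_subst[of \<Gamma> y y']) auto
  finally show ?thesis .
qed

lemma mcs_Pto_fun: "mcs \<Gamma> \<Longrightarrow> x \<hookrightarrow> y \<in> \<Gamma> \<Longrightarrow> x \<hookrightarrow> z \<in> \<Gamma> \<Longrightarrow> y \<^bold>= z \<in> \<Gamma>"
  using mcs_Imp[OF _ Ax4, of \<Gamma> x y z] by simp

section \<open>Similarity of maximal consistent sets and memory states\<close>

definition similar ::
    "'v set \<Rightarrow> nat \<Rightarrow> ('v \<Rightarrow> 'l) \<Rightarrow> ('l \<rightharpoonup> 'l) \<Rightarrow> 'v form set \<Rightarrow> bool" where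
  "similar X \<alpha> s h \<Gamma> \<longleftrightarrow> mcs \<Gamma> \<and> finite (dom h) \<and>
    (\<forall>x\<in>X. \<forall>y\<in>X. x \<^bold>= y \<in> \<Gamma> \<longleftrightarrow> s x = s y) \<and>
    (\<forall>x\<in>X. \<forall>y\<in>X. x \<hookrightarrow> y \<in> \<Gamma> \<longleftrightarrow> h (s x) = Some (s y)) \<and>
    (\<forall>x\<in>X. Alloc x \<in> \<Gamma> \<longleftrightarrow> s x \<in> dom h) \<and>
    (\<forall>\<beta>\<le>\<alpha>. size_ge \<beta> \<in> \<Gamma> \<longleftrightarrow> \<beta> \<le> card (dom h))"

lemma similarD:
  assumes "similar X \<alpha> s h \<Gamma>"
  shows "mcs \<Gamma>" "finite (dom h)"
    and "x \<in> X \<Longrightarrow> y \<in> X \<Longrightarrow> x \<^bold>= y \<in> \<Gamma> \<longleftrightarrow> s x = s y"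
    and "x \<in> X \<Longrightarrow> y \<in> X \<Longrightarrow> x \<hookrightarrow> y \<in> \<Gamma> \<longleftrightarrow> h (s x) = Some (s y)"
    and "x \<in> X \<Longrightarrow> Alloc x \<in> \<Gamma> \<longleftrightarrow> s x \<in> dom h"
    and "\<beta> \<le> \<alpha> \<Longrightarrow> size_ge \<beta> \<in> \<Gamma> \<longleftrightarrow> \<beta> \<le> card (dom h)"
  using assms unfolding similar_def by blast+

text \<open>Equalities and points-to are inherited from the whole by \<open>joins_Eq\<close> and
  \<open>joins_Pto\<close>, so only \<open>Alloc\<close> and the size remain to be checked for a
  component.\<close>

lemma similar_component:
  assumes sim: "similar X \<alpha> s h \<Gamma>" and j: "joins \<Gamma> \<Gamma>1 \<Gamma>2"
    and h: "dom h1 \<inter> dom h2 = {}" "h = h1 ++ h2"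
    and al: "\<And>x. x \<in> X \<Longrightarrow> Alloc x \<in> \<Gamma>1 \<longleftrightarrow> s x \<in> dom h1"
    and sz: "\<And>\<beta>. \<beta> \<le> \<alpha>1 \<Longrightarrow> size_ge \<beta> \<in> \<Gamma>1 \<longleftrightarrow> \<beta> \<le> card (dom h1)"
  shows "similar X \<alpha>1 s h1 \<Gamma>1"
proof -
  have *: "h1 l = Some v \<longleftrightarrow> h l = Some v \<and> l \<in> dom h1" for l v
  proof (cases "l \<in> dom h1")
    case True
    then have "l \<notin> dom h2" using h(1) by blast
    then show ?thesis using True by (simp add: h(2) map_add_dom_app_simps(3))
  qed auto
  have "x \<hookrightarrow> y \<in> \<Gamma>1 \<longleftrightarrow> h1 (s x) = Some (s y)" if "x \<in> X" "y \<in> X" for x y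
    using joins_Pto[OF j, of x y] al[OF that(1)] similarD(4)[OF sim that] *[of "s x" "s y"] by simp
  moreover have "x \<^bold>= y \<in> \<Gamma>1 \<longleftrightarrow> s x = s y" if "x \<in> X" "y \<in> X" for x y
    using joins_Eq(1)[OF j] similarD(3)[OF sim that] by simp
  moreover have "finite (dom h1)" "mcs \<Gamma>1"
    using similarD(2)[OF sim] h joins_mcs[OF j] by auto
  ultimately show ?thesis using al sz unfolding similar_def by blast
qed

text \<open>Keeps one variable per location, which yields the pairwise distinctness that splitting
  off named cells demands.\<close>

lemma representatives:
  assumes "finite Z" "\<And>x y. x \<in> Z \<Longrightarrow> y \<in> Z \<Longrightarrow> x \<^bold>= y \<in> \<Gamma> \<longleftrightarrow> s x = s y"
  obtains Y where "Y \<subseteq> Z" "finite Y" "s ` Y = s ` Z" "card Y = card (s ` Z)"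
    "pairwise (\<lambda>x y. x \<^bold>= y \<notin> \<Gamma>) Y"
proof -
  obtain Y where Y: "Y \<subseteq> Z" "inj_on s Y" "s ` Z = s ` Y"
    using subset_image_inj[of "s ` Z" s Z] by auto
  have "pairwise (\<lambda>x y. x \<^bold>= y \<notin> \<Gamma>) Y"
    using Y(1,2) assms(2) unfolding pairwise_def inj_on_def by blast
  then show thesis
    using that[of Y] Y card_image[OF Y(2)] finite_subset[OF Y(1) assms(1)] by simp
qed

lemma card_image_Alloc_le_size_ge:
  assumes "finite X" "mcs \<Gamma>" "\<And>x y. x \<in> X \<Longrightarrow> y \<in> X \<Longrightarrow> x \<^bold>= y \<in> \<Gamma> \<longleftrightarrow> s x = s y"
  shows "size_ge (card (s ` {x \<in> X. Alloc x \<in> \<Gamma>})) \<in> \<Gamma>"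
proof -
  let ?Z = "{x \<in> X. Alloc x \<in> \<Gamma>}"
  obtain Y where Y: "Y \<subseteq> ?Z" "finite Y" "card Y = card (s ` ?Z)"
    "pairwise (\<lambda>x y. x \<^bold>= y \<notin> \<Gamma>) Y"
    by (rule representatives[of ?Z \<Gamma> s]) (use assms in auto)
  have "size_ge (card Y) \<in> \<Gamma>"
    by (rule card_le_size_ge[OF Y(2) assms(2) _ Y(4)]) (use Y(1) in blast)
  then show ?thesis using Y(3) by simp
qed

text \<open>Truncation at \<open>\<alpha>\<close> gives a size even to sets that contain every
  \<open>size_ge \<beta>\<close>.\<close>

lemma truncated_size:
  assumes "mcs \<Gamma>" shows "\<exists>b\<le>\<alpha>. \<forall>\<beta>\<le>\<alpha>. size_ge \<beta> \<in> \<Gamma> \<longleftrightarrow> \<beta> \<le> b"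
proof (induction \<alpha>)
  case 0
  then show ?case using assms by auto
next
  case (Suc \<alpha>)
  then obtain b where b: "b \<le> \<alpha>" "\<forall>\<beta>\<le>\<alpha>. size_ge \<beta> \<in> \<Gamma> \<longleftrightarrow> \<beta> \<le> b" by blast
  show ?case
  proof (cases "size_ge (Suc \<alpha>) \<in> \<Gamma>")
    case True
    then show ?thesis using size_ge_mono[OF _ assms] by blast
  next
    case False
    then show ?thesis using b by (metis le_Suc_eq not_less_eq_eq)
  qed
qed

section \<open>Transfer of splits between sets and heaps\<close>

text \<open>Each named cell goes to the side whose set allocates it; the anonymous cells are then
  distributed so that both sides get sizes matching \<open>\<Gamma>1\<close> and
  \<open>\<Gamma>2\<close>.\<close>

lemma similar_split_heap:
  assumes sim: "similar X \<alpha> s h \<Gamma>" and j: "joins \<Gamma> \<Gamma>1 \<Gamma>2" and X: "finite X"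
    and \<alpha>: "card X \<le> \<alpha>1" "card X \<le> \<alpha>2" "\<alpha>1 + \<alpha>2 \<le> \<alpha>"
  obtains h1 h2 where "dom h1 \<inter> dom h2 = {}" "h = h1 ++ h2"
    "similar X \<alpha>1 s h1 \<Gamma>1" "similar X \<alpha>2 s h2 \<Gamma>2"
proof -
  have m: "mcs \<Gamma>1" "mcs \<Gamma>2" using joins_mcs[OF j] by auto
  have eq1: "x \<^bold>= y \<in> \<Gamma>1 \<longleftrightarrow> s x = s y" and eq2: "x \<^bold>= y \<in> \<Gamma>2 \<longleftrightarrow> s x = s y"
    if "x \<in> X" "y \<in> X" for x y
    using joins_Eq[OF j] similarD(3)[OF sim that] by auto
  define A1 A2 where A: "A1 = s ` {x \<in> X. Alloc x \<in> \<Gamma>1}" "A2 = s ` {x \<in> X. Alloc x \<in> \<Gamma>2}"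
  have A1: "s x \<in> A1 \<longleftrightarrow> Alloc x \<in> \<Gamma>1" if x: "x \<in> X" for x
  proof
    assume "s x \<in> A1"
    then obtain y where y: "y \<in> X" "s x = s y" "Alloc y \<in> \<Gamma>1" unfolding A by blast
    then have "x \<^bold>= y \<in> \<Gamma>1" using eq1 x by blast
    then show "Alloc x \<in> \<Gamma>1" using mcs_Alloc_cong[OF m(1)] y(3) by blast
  qed (use x A in blast)
  have A2: "s x \<in> A2 \<longleftrightarrow> Alloc x \<in> \<Gamma>2" if x: "x \<in> X" for x
  proof
    assume "s x \<in> A2"
    then obtain y where y: "y \<in> X" "s x = s y" "Alloc y \<in> \<Gamma>2" unfolding A by blast
    then have "x \<^bold>= y \<in> \<Gamma>2" using eq2 x by blast
    then show "Alloc x \<in> \<Gamma>2" using mcs_Alloc_cong[OF m(2)] y(3) by blast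
  qed (use x A in blast)
  have sX: "A1 \<subseteq> s ` X" "A2 \<subseteq> s ` X" unfolding A by blast+
  have disj: "A1 \<inter> A2 = {}"
  proof (rule equals0I)
    fix l assume l: "l \<in> A1 \<inter> A2"
    then obtain x where "x \<in> X" "l = s x" using sX by blast
    then show False using l A1 A2 joins_Alloc_disjoint[OF j] by blast
  qed
  have named: "A1 \<union> A2 = s ` X \<inter> dom h"
  proof (intro equalityI subsetI)
    fix l assume l: "l \<in> A1 \<union> A2"
    then obtain x where "x \<in> X" "l = s x" using sX by blast
    then show "l \<in> s ` X \<inter> dom h"
      using l A1 A2 joins_Alloc[OF j] similarD(5)[OF sim] by blast
  next
    fix l assume "l \<in> s ` X \<inter> dom h"
    then show "l \<in> A1 \<union> A2"
      using A1 A2 joins_Alloc[OF j] similarD(5)[OF sim] by blast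
  qed
  have fA: "finite A1" "finite A2" using X finite_surj sX by blast+
  have cA: "card A1 \<le> card X" "card A2 \<le> card X"
    using X card_mono[OF _ sX(1)] card_mono[OF _ sX(2)] card_image_le[OF X, of s] by auto
  \<comment> \<open>Only truncated sizes of the components are known. They are raised to numbers
    that add up to the size of \<open>h\<close>, without changing any comparison up to
    \<open>\<alpha>1\<close> and \<open>\<alpha>2\<close>.\<close>
  obtain n1 n2 where n: "n1 + n2 = card (dom h)"
    "\<And>\<beta>. \<beta> \<le> \<alpha>1 \<Longrightarrow> size_ge \<beta> \<in> \<Gamma>1 \<longleftrightarrow> \<beta> \<le> n1" "\<And>\<beta>. \<beta> \<le> \<alpha>2 \<Longrightarrow> size_ge \<beta> \<in> \<Gamma>2 \<longleftrightarrow> \<beta> \<le> n2"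
  proof -
    obtain b1 where b1: "b1 \<le> \<alpha>1" "\<And>\<beta>. \<beta> \<le> \<alpha>1 \<Longrightarrow> size_ge \<beta> \<in> \<Gamma>1 \<longleftrightarrow> \<beta> \<le> b1"
      using truncated_size[OF m(1)] by blast
    obtain b2 where b2: "b2 \<le> \<alpha>2" "\<And>\<beta>. \<beta> \<le> \<alpha>2 \<Longrightarrow> size_ge \<beta> \<in> \<Gamma>2 \<longleftrightarrow> \<beta> \<le> b2"
      using truncated_size[OF m(2)] by blast
    have "size_ge b1 \<in> \<Gamma>1" "size_ge b2 \<in> \<Gamma>2" using b1 b2 by auto
    then have "size_ge (b1 + b2) \<in> \<Gamma>" by (rule joins_size_ge_add[OF j])
    moreover have "b1 + b2 \<le> \<alpha>" using b1(1) b2(1) \<alpha>(3) by linarith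
    ultimately have le: "b1 + b2 \<le> card (dom h)" using similarD(6)[OF sim] by blast
    \<comment> \<open>Below both ceilings the truncated sizes are exact, so there is no
      surplus.\<close>
    have eq: "card (dom h) = b1 + b2" if lt: "b1 < \<alpha>1" "b2 < \<alpha>2"
    proof -
      have "size_ge (Suc b1) \<notin> \<Gamma>1" "size_ge (Suc b2) \<notin> \<Gamma>2"
        using b1(2)[of "Suc b1"] b2(2)[of "Suc b2"] lt by auto
      then have "size_ge (Suc b1 + Suc b2 - 1) \<notin> \<Gamma>" by (rule joins_not_size_ge[OF j])
      moreover have "Suc b1 + Suc b2 - 1 \<le> \<alpha>" using lt \<alpha>(3) by linarith
      ultimately have "\<not> Suc b1 + Suc b2 - 1 \<le> card (dom h)" using similarD(6)[OF sim] by blast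
      then show ?thesis using le by linarith
    qed
    show thesis
    \<comment> \<open>A surplus is absorbed by a side at its ceiling: the left one if
      \<open>b2\<close> is below \<open>\<alpha>2\<close>, otherwise the right one.\<close>
    proof (cases "b2 < \<alpha>2")
      case True
      have "size_ge \<beta> \<in> \<Gamma>1 \<longleftrightarrow> \<beta> \<le> card (dom h) - b2" if \<beta>: "\<beta> \<le> \<alpha>1" for \<beta>
        using b1(1) b1(2)[OF \<beta>] eq[OF _ True] le \<beta> by linarith
      moreover have "card (dom h) - b2 + b2 = card (dom h)" using le by linarith
      ultimately show thesis using that b2(2) by blast
    next
      case False
      then have "size_ge \<beta> \<in> \<Gamma>2 \<longleftrightarrow> \<beta> \<le> card (dom h) - b1" if \<beta>: "\<beta> \<le> \<alpha>2" for \<beta>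
        using b2(1) b2(2)[OF \<beta>] le \<beta> by linarith
      moreover have "b1 + (card (dom h) - b1) = card (dom h)" using le by linarith
      ultimately show thesis using that b1(2) by blast
    qed
  qed
  have "size_ge (card A1) \<in> \<Gamma>1" "size_ge (card A2) \<in> \<Gamma>2"
    unfolding A using card_image_Alloc_le_size_ge[OF X] m eq1 eq2 by blast+
  \<comment> \<open>The bounds \<open>card X \<le> \<alpha>1\<close> and
    \<open>card X \<le> \<alpha>2\<close> keep the numbers of named cells in the range where
    \<open>n1\<close> and \<open>n2\<close> reflect the sets.\<close>
  then have le: "card A1 \<le> n1" "card A2 \<le> n2" using n(2,3) cA \<alpha> le_trans by blast+
  define D where "D = dom h - (A1 \<union> A2)"
  have fin: "finite (dom h)" by (rule similarD(2)[OF sim])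
  have "card (A1 \<union> A2) = card A1 + card A2" using fA disj by (simp add: card_Un_disjoint)
  then have "card D = card (dom h) - (card A1 + card A2)"
    unfolding D_def using card_Diff_subset[of "A1 \<union> A2" "dom h"] named finite_UnI[OF fA] by simp
  \<comment> \<open>There are \<open>n1 + n2 - card A1 - card A2\<close> anonymous cells, and
    \<open>n2\<close> is at least \<open>card A2\<close>.\<close>
  then have "n1 - card A1 \<le> card D" using n(1) le by linarith
  then obtain D1 where D1: "D1 \<subseteq> D" "card D1 = n1 - card A1" "finite D1"
    by (rule obtain_subset_with_card_n)
  let ?D = "A1 \<union> D1"
  have D: "?D \<subseteq> dom h" using D1(1) named unfolding D_def by blast
  have cD: "card ?D = n1"
    using D1 le fA(1) unfolding D_def by (subst card_Un_disjoint) auto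
  define h1 h2 where h: "h1 = h |` ?D" "h2 = h |` (- ?D)"
  have dh: "dom h1 = ?D" "dom h2 = dom h - ?D" "h = h1 ++ h2"
    unfolding h using split_heap[OF D] by auto
  have c2: "card (dom h2) = n2"
    unfolding dh(2) using n(1) cD D fin by (subst card_Diff_subset) (auto intro: finite_subset)
  have al1: "Alloc x \<in> \<Gamma>1 \<longleftrightarrow> s x \<in> dom h1" if x: "x \<in> X" for x
    using A1[OF x] D1(1) named x unfolding dh(1) D_def by blast
  have al2: "Alloc x \<in> \<Gamma>2 \<longleftrightarrow> s x \<in> dom h2" if x: "x \<in> X" for x
    using al1[OF x] joins_Alloc_disjoint[OF j, of x] joins_Alloc[OF j, of x]
      similarD(5)[OF sim x] unfolding dh(1,2) by blast
  have d12: "dom h1 \<inter> dom h2 = {}" unfolding dh(1,2) by blast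
  have "similar X \<alpha>1 s h1 \<Gamma>1"
    by (rule similar_component[OF sim j d12 dh(3) al1]) (simp_all add: dh(1) cD n(2))
  moreover have "similar X \<alpha>2 s h2 \<Gamma>2"
  proof (rule similar_component[OF sim joins_comm[OF j] _ _ al2])
    show "dom h2 \<inter> dom h1 = {}" using d12 by blast
    show "h = h2 ++ h1" using dh(3) map_add_comm[OF d12] by simp
  qed (simp_all add: c2 n(3))
  ultimately show thesis using that d12 dh(3) by blast
qed

text \<open>\<open>\<Gamma>1\<close> receives a finite exact size, the size of \<open>h1\<close> cut
  off at \<open>\<alpha>1\<close>, and \<open>\<Gamma>2\<close> the rest. If cells are cut off,
  \<open>\<Gamma>2\<close> gets too many of them, which goes unnoticed when \<open>h2\<close>
  already reaches \<open>\<alpha>2\<close>; hence the premise \<open>small\<close>.\<close>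

lemma similar_split_mcs_aux:
  assumes sim: "similar X \<alpha> s h \<Gamma>" and X: "finite X"
    and h: "dom h1 \<inter> dom h2 = {}" "h = h1 ++ h2"
    and \<alpha>: "card X \<le> \<alpha>1" "card X \<le> \<alpha>2" "\<alpha>1 + \<alpha>2 \<le> \<alpha>"
    and small: "card (dom h1) \<le> \<alpha>1 \<or> \<alpha>2 \<le> card (dom h2)"
  shows "\<exists>\<Gamma>1 \<Gamma>2. joins \<Gamma> \<Gamma>1 \<Gamma>2 \<and> similar X \<alpha>1 s h1 \<Gamma>1 \<and> similar X \<alpha>2 s h2 \<Gamma>2"
proof -
  note m = similarD(1)[OF sim]
  have fin: "finite (dom h1)" "finite (dom h2)" using similarD(2)[OF sim] h by auto
  have ch: "card (dom h) = card (dom h1) + card (dom h2)"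
    using h fin by (simp add: card_Un_disjoint Un_commute)
  have dh: "dom h = dom h1 \<union> dom h2" using h by auto
  obtain Y1 where Y1: "Y1 \<subseteq> {x \<in> X. s x \<in> dom h1}" "finite Y1"
    "s ` Y1 = s ` {x \<in> X. s x \<in> dom h1}" "card Y1 = card (s ` {x \<in> X. s x \<in> dom h1})"
    "pairwise (\<lambda>x y. x \<^bold>= y \<notin> \<Gamma>) Y1"
    by (rule representatives[of "{x \<in> X. s x \<in> dom h1}" \<Gamma> s])
      (use X similarD(3)[OF sim] in auto)
  obtain Y2 where Y2: "Y2 \<subseteq> {x \<in> X. s x \<in> dom h2}" "finite Y2"
    "s ` Y2 = s ` {x \<in> X. s x \<in> dom h2}" "card Y2 = card (s ` {x \<in> X. s x \<in> dom h2})"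
    "pairwise (\<lambda>x y. x \<^bold>= y \<notin> \<Gamma>) Y2"
    by (rule representatives[of "{x \<in> X. s x \<in> dom h2}" \<Gamma> s])
      (use X similarD(3)[OF sim] in auto)
  have cY: "card Y1 \<le> card (dom h1)" "card Y2 \<le> card (dom h2)"
    unfolding Y1(4) Y2(4) using fin by (auto intro: card_mono)
  have "Y1 \<subseteq> X" "Y2 \<subseteq> X" using Y1(1) Y2(1) by auto
  then have cX: "card Y1 \<le> card X" "card Y2 \<le> card X" using card_mono[OF X] by auto
  have across: "x \<^bold>= y \<notin> \<Gamma> \<and> y \<^bold>= x \<notin> \<Gamma> \<and> x \<noteq> y" if "x \<in> Y1" "y \<in> Y2" for x y
  proof -
    have "x \<in> X" "y \<in> X" "s x \<in> dom h1" "s y \<in> dom h2" using that Y1(1) Y2(1) by blast+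
    moreover from this have "s x \<noteq> s y" using h(1) by (metis disjoint_iff)
    ultimately show ?thesis
      using similarD(3)[OF sim, of x y] similarD(3)[OF sim, of y x] by auto
  qed
  \<comment> \<open>\<open>k\<close> is the exact size of \<open>\<Gamma>1\<close>, and
    \<open>r\<close> counts its anonymous cells; \<open>k\<close> is at least \<open>card Y1\<close>
    because both \<open>card (dom h1)\<close> and \<open>\<alpha>1\<close> are.\<close>
  define k r where kr: "k = min (card (dom h1)) \<alpha>1" "r = k - card Y1"
  have k: "card Y1 + r = k" using kr cY cX \<alpha> by auto
  have disj: "Y1 \<inter> Y2 = {}" using across by blast
  have pw: "pairwise (\<lambda>x y. x \<^bold>= y \<notin> \<Gamma>) (Y1 \<union> Y2)"
    using Y1(5) Y2(5) across unfolding pairwise_def by blast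
  have alY: "Alloc y \<in> \<Gamma>" if "y \<in> Y1 \<union> Y2" for y
  proof -
    have "y \<in> X" "s y \<in> dom h" using that Y1(1) Y2(1) unfolding dh by auto
    then show ?thesis using similarD(5)[OF sim] by blast
  qed
  have "card Y1 + (card Y2 + r) \<le> \<alpha>" "card Y1 + (card Y2 + r) \<le> card (dom h)"
    using k kr(1) cX cY \<alpha> ch by linarith+
  then have sz: "size_ge (card Y1 + (card Y2 + r)) \<in> \<Gamma>" using similarD(6)[OF sim] by blast
  obtain \<Gamma>1 \<Gamma>2 where j: "joins \<Gamma> \<Gamma>1 \<Gamma>2" "exact_size (card Y1 + r) \<Gamma>1"
    "\<And>y. y \<in> Y1 \<Longrightarrow> Alloc y \<in> \<Gamma>1" "\<And>y. y \<in> Y2 \<Longrightarrow> Alloc y \<in> \<Gamma>2"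
    using split_mcs[OF m Y1(2) Y2(2) disj alY pw sz] by metis
  have ex: "exact_size k \<Gamma>1" using j(2) k by simp
  have mm: "mcs \<Gamma>1" "mcs \<Gamma>2" using joins_mcs[OF j(1)] by auto
  \<comment> \<open>The split controls only the representatives in \<open>Y1\<close>; every other
    variable at the same location follows by congruence.\<close>
  have in1: "Alloc x \<in> \<Gamma>1" if x: "x \<in> X" "s x \<in> dom h1" for x
  proof -
    have "s x \<in> s ` Y1" unfolding Y1(3) using x by blast
    then obtain y where y: "y \<in> Y1" "s y = s x" by auto
    moreover have "y \<in> X" using y(1) Y1(1) by blast
    ultimately have "y \<^bold>= x \<in> \<Gamma>1"
      using joins_Eq(1)[OF j(1), of y x] similarD(3)[OF sim, of y x] x(1) by simp
    then show ?thesis using mcs_Alloc_cong[OF mm(1)] j(3)[OF y(1)] by simp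
  qed
  have in2: "Alloc x \<in> \<Gamma>2" if x: "x \<in> X" "s x \<in> dom h2" for x
  proof -
    have "s x \<in> s ` Y2" unfolding Y2(3) using x by blast
    then obtain y where y: "y \<in> Y2" "s y = s x" by auto
    moreover have "y \<in> X" using y(1) Y2(1) by blast
    ultimately have "y \<^bold>= x \<in> \<Gamma>2"
      using joins_Eq(2)[OF j(1), of y x] similarD(3)[OF sim, of y x] x(1) by simp
    then show ?thesis using mcs_Alloc_cong[OF mm(2)] j(4)[OF y(1)] by simp
  qed
  have al: "Alloc x \<in> \<Gamma>1 \<longleftrightarrow> s x \<in> dom h1" "Alloc x \<in> \<Gamma>2 \<longleftrightarrow> s x \<in> dom h2" if x: "x \<in> X" for x
    using in1[OF x] in2[OF x] joins_Alloc[OF j(1), of x] joins_Alloc_disjoint[OF j(1), of x]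
      similarD(5)[OF sim x] unfolding dh by blast+
  have "similar X \<alpha>1 s h1 \<Gamma>1"
  proof (rule similar_component[OF sim j(1) h al(1)])
    show "size_ge \<beta> \<in> \<Gamma>1 \<longleftrightarrow> \<beta> \<le> card (dom h1)" if "\<beta> \<le> \<alpha>1" for \<beta>
      using ex that kr(1) unfolding exact_size_def by simp
  qed
  moreover have "similar X \<alpha>2 s h2 \<Gamma>2"
  proof (rule similar_component[OF sim joins_comm[OF j(1)] _ _ al(2)])
    show "dom h2 \<inter> dom h1 = {}" using h(1) by blast
    show "h = h2 ++ h1" using h map_add_comm[OF h(1)] by simp
    fix \<beta> assume \<beta>: "\<beta> \<le> \<alpha>2"
    then have "k + \<beta> \<le> \<alpha>" using kr(1) \<alpha>(3) by linarith
    then have "size_ge \<beta> \<in> \<Gamma>2 \<longleftrightarrow> k + \<beta> \<le> card (dom h)"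
      using joins_size_ge_diff[OF j(1) ex] similarD(6)[OF sim] by simp
    \<comment> \<open>Either \<open>k\<close> is the size of \<open>h1\<close> and cancels, or
      \<open>h2\<close> has at least \<open>\<alpha>2\<close> cells and both sides hold.\<close>
    then show "size_ge \<beta> \<in> \<Gamma>2 \<longleftrightarrow> \<beta> \<le> card (dom h2)"
      using small \<beta> kr(1) ch by linarith
  qed
  ultimately show ?thesis using j(1) by blast
qed

text \<open>If the size premise of the auxiliary lemma fails, \<open>h1\<close> exceeds
  \<open>\<alpha>1\<close> and \<open>h2\<close> stays below \<open>\<alpha>2\<close>, so the
  premise holds with the two sides interchanged.\<close>

lemma similar_split_mcs:
  assumes sim: "similar X \<alpha> s h \<Gamma>" and X: "finite X"
    and h: "dom h1 \<inter> dom h2 = {}" "h = h1 ++ h2"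
    and \<alpha>: "card X \<le> \<alpha>1" "card X \<le> \<alpha>2" "\<alpha>1 + \<alpha>2 \<le> \<alpha>"
  obtains \<Gamma>1 \<Gamma>2 where "joins \<Gamma> \<Gamma>1 \<Gamma>2" "similar X \<alpha>1 s h1 \<Gamma>1" "similar X \<alpha>2 s h2 \<Gamma>2"
proof (cases "card (dom h1) \<le> \<alpha>1 \<or> \<alpha>2 \<le> card (dom h2)")
  case True
  then show ?thesis using that similar_split_mcs_aux[OF sim X h \<alpha>] by blast
next
  case False
  have "dom h2 \<inter> dom h1 = {}" "h = h2 ++ h1" using h map_add_comm[OF h(1)] by auto
  moreover have "\<alpha>2 + \<alpha>1 \<le> \<alpha>" "card (dom h2) \<le> \<alpha>2 \<or> \<alpha>1 \<le> card (dom h1)"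
    using \<alpha>(3) False by linarith+
  ultimately obtain \<Gamma>1 \<Gamma>2 where "joins \<Gamma> \<Gamma>2 \<Gamma>1" "similar X \<alpha>2 s h2 \<Gamma>2" "similar X \<alpha>1 s h1 \<Gamma>1"
    using similar_split_mcs_aux[OF sim X _ _ \<alpha>(2,1)] by blast
  then show ?thesis using that joins_comm by blast
qed

section \<open>Truth of formulae under similarity\<close>

text \<open>The precision \<open>\<alpha>\<close> that similarity needs in order to decide a formula; \<open>m\<close> bounds the
  number of variables.\<close>

primrec precision :: "nat \<Rightarrow> 'v form \<Rightarrow> nat" where
  "precision m (x \<^bold>= y) = m"
| "precision m (x \<hookrightarrow> y) = m"
| "precision m Emp = m"
| "precision m (Alloc x) = m"
| "precision m (\<^bold>\<not> \<phi>) = precision m \<phi>"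
| "precision m (\<phi> \<^bold>\<and> \<psi>) = max (precision m \<phi>) (precision m \<psi>)"
| "precision m (\<phi> \<^bold>* \<psi>) = precision m \<phi> + precision m \<psi>"

lemma le_precision: "m \<le> precision m \<phi>"
  by (induction \<phi>) auto

lemma similar_truth:
  assumes X: "finite X" "card X \<le> m" "0 < m"
  shows "set_form \<phi> \<subseteq> X \<Longrightarrow> precision m \<phi> \<le> \<alpha> \<Longrightarrow> similar X \<alpha> s h \<Gamma> \<Longrightarrow>
    \<phi> \<in> \<Gamma> \<longleftrightarrow> sat s h \<phi>"
proof (induction \<phi> arbitrary: \<alpha> h \<Gamma>)
  case (Eq x y)
  then show ?case using similarD(3)[OF Eq(3)] by simp
next
  case (Pto x y)
  then show ?case using similarD(4)[OF Pto(3)] by simp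
next
  case Emp
  \<comment> \<open>Emptiness is the failure of \<open>size_ge 1\<close>; the assumption
    \<open>0 < m\<close> makes \<open>\<alpha>\<close> at least 1, so that this size is
    observed.\<close>
  have "size_ge 1 \<in> \<Gamma> \<longleftrightarrow> 1 \<le> card (dom h)" using similarD(6)[OF Emp(3), of 1] Emp(2) X(3) by simp
  then show ?case using similarD(1,2)[OF Emp(3)] by (simp add: Suc_le_eq card_gt_0_iff)
next
  case (Alloc x)
  then show ?case using similarD(5)[OF Alloc(3)] by simp
next
  case (Neg \<phi>)
  then show ?case using similarD(1)[OF Neg(4)] by simp
next
  case (And \<phi> \<psi>)
  then show ?case using And.IH(1)[OF _ _ And(5)] And.IH(2)[OF _ _ And(5)] similarD(1)[OF And(5)] by simp
next
  case (Star \<phi> \<psi>)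
  let ?a = "precision m \<phi>" and ?b = "precision m \<psi>"
  \<comment> \<open>Precisions add up at \<open>Star\<close> and each is at least \<open>m\<close>,
    which is what the two splitting lemmas demand of \<open>\<alpha>1\<close> and
    \<open>\<alpha>2\<close>.\<close>
  have c: "card X \<le> ?a" "card X \<le> ?b" "?a + ?b \<le> \<alpha>"
    
    using le_precision[of m \<phi>] le_precision[of m \<psi>] X(2) Star.prems(2) by auto
  have v: "set_form \<phi> \<subseteq> X" "set_form \<psi> \<subseteq> X" using Star.prems(1) by auto
  show ?case
  proof
    assume "\<phi> \<^bold>* \<psi> \<in> \<Gamma>"
    then obtain \<Gamma>1 \<Gamma>2 where \<Gamma>: "joins \<Gamma> \<Gamma>1 \<Gamma>2" "\<phi> \<in> \<Gamma>1" "\<psi> \<in> \<Gamma>2"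
      by (rule StarE[OF similarD(1)[OF Star.prems(3)]])
    obtain h1 h2 where h: "dom h1 \<inter> dom h2 = {}" "h = h1 ++ h2"
      "similar X ?a s h1 \<Gamma>1" "similar X ?b s h2 \<Gamma>2"
      by (rule similar_split_heap[OF Star.prems(3) \<Gamma>(1) X(1) c])
    have "sat s h1 \<phi>" "sat s h2 \<psi>"
      using Star.IH(1)[OF v(1) order_refl h(3)] Star.IH(2)[OF v(2) order_refl h(4)] \<Gamma>(2,3) by auto
    then show "sat s h (\<phi> \<^bold>* \<psi>)" using h(1,2) unfolding sat.simps by blast
  next
    assume "sat s h (\<phi> \<^bold>* \<psi>)"
    then obtain h1 h2 where h: "dom h1 \<inter> dom h2 = {}" "h = h1 ++ h2" "sat s h1 \<phi>" "sat s h2 \<psi>"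
      by auto
    obtain \<Gamma>1 \<Gamma>2 where \<Gamma>: "joins \<Gamma> \<Gamma>1 \<Gamma>2" "similar X ?a s h1 \<Gamma>1" "similar X ?b s h2 \<Gamma>2"
      by (rule similar_split_mcs[OF Star.prems(3) X(1) h(1,2) c])
    have "\<phi> \<in> \<Gamma>1" "\<psi> \<in> \<Gamma>2"
      using Star.IH(1)[OF v(1) order_refl \<Gamma>(2)] Star.IH(2)[OF v(2) order_refl \<Gamma>(3)] h(3,4) by auto
    then show "\<phi> \<^bold>* \<psi> \<in> \<Gamma>" by (rule joins_Star[OF \<Gamma>(1)])
  qed
qed

section \<open>Completeness\<close>

text \<open>Each variable is sent to a chosen member of its equivalence class, and the countably
  many variables are embedded into the infinite set of locations.\<close>

lemma realize_Eq:
  fixes \<Gamma> :: "'v::countable form set"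
  assumes m: "mcs \<Gamma>"
  obtains s :: "'v \<Rightarrow> 'l::infinite" where "\<And>x y. x \<^bold>= y \<in> \<Gamma> \<longleftrightarrow> s x = s y"
proof -
  obtain g :: "nat \<Rightarrow> 'l" where g: "inj g"
    using infinite_countable_subset[OF infinite_UNIV] by blast
  define rep where "rep x = (SOME z. x \<^bold>= z \<in> \<Gamma>)" for x
  have rep: "x \<^bold>= rep x \<in> \<Gamma>" for x
    unfolding rep_def by (rule someI) (rule mcs_Eq_refl[OF m])
  have "x \<^bold>= y \<in> \<Gamma> \<longleftrightarrow> rep x = rep y" for x y
  proof
    assume "x \<^bold>= y \<in> \<Gamma>"
    \<comment> \<open>Equal variables have the same candidates, so the choice operator picks the
      same one.\<close>
    then show "rep x = rep y" using mcs_Eq_cong[OF m, of x y] unfolding rep_def by simp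
  next
    assume "rep x = rep y"
    then have "rep x \<^bold>= y \<in> \<Gamma>" using mcs_Eq_sym[OF m rep[of y]] by simp
    then show "x \<^bold>= y \<in> \<Gamma>" using mcs_Eq_cong[OF m rep[of x]] by simp
  qed
  moreover have "rep x = rep y \<longleftrightarrow> g (to_nat (rep x)) = g (to_nat (rep y))" for x y
    by (simp add: inj_eq[OF g])
  ultimately show thesis using that[of "\<lambda>x. g (to_nat (rep x))"] by simp
qed

text \<open>The domain consists of the locations \<open>A\<close> of allocated variables and of
  anonymous cells \<open>B\<close> that fill it up to the size of \<open>\<Gamma>\<close> truncated
  at \<open>\<alpha>\<close>.\<close>

lemma realize:
  fixes \<Gamma> :: "'v::countable form set"
  assumes m: "mcs \<Gamma>" and X: "finite X" "card X \<le> \<alpha>"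
  obtains s :: "'v \<Rightarrow> 'l::infinite" and h where "similar X \<alpha> s h \<Gamma>"
proof -
  obtain s :: "'v \<Rightarrow> 'l" where s: "\<And>x y. x \<^bold>= y \<in> \<Gamma> \<longleftrightarrow> s x = s y"
    using realize_Eq[OF m] by blast
  define A where "A = s ` {x \<in> X. Alloc x \<in> \<Gamma>}"
  have A: "s x \<in> A \<longleftrightarrow> Alloc x \<in> \<Gamma>" if "x \<in> X" for x
    using mcs_Alloc_cong[OF m] s that unfolding A_def by blast
  have fA: "finite A" "A \<subseteq> s ` X" using X unfolding A_def by auto
  obtain b where b: "b \<le> \<alpha>" "\<And>\<beta>. \<beta> \<le> \<alpha> \<Longrightarrow> size_ge \<beta> \<in> \<Gamma> \<longleftrightarrow> \<beta> \<le> b"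
    using truncated_size[OF m] by blast
  have "card A \<le> \<alpha>"
    using card_mono[OF finite_imageI[OF X(1)] fA(2)] card_image_le[OF X(1), of s] X(2) by linarith
  moreover have "size_ge (card A) \<in> \<Gamma>"
    unfolding A_def by (rule card_image_Alloc_le_size_ge[OF X(1) m s])
  ultimately have cA: "card A \<le> b" using b(2) by blast
  have inf: "infinite (UNIV - s ` X)"
    using X(1) Diff_infinite_finite infinite_UNIV finite_imageI by blast
  \<comment> \<open>The default target avoids all variables of \<open>X\<close>, so that an
    allocated variable without a points-to formula over \<open>X\<close> points to none of
    them.\<close>
  then obtain d where d: "d \<notin> s ` X" using infinite_imp_nonempty by blast
  obtain B where B: "finite B" "card B = b - card A" "B \<subseteq> UNIV - s ` X"
    using infinite_arbitrarily_large[OF inf] by blast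
  \<comment> \<open>The candidate targets of a location. Any choice among them is right, because
    \<open>Ax4\<close> makes all targets of one variable equal.\<close>
  define P where "P l y \<longleftrightarrow> y \<in> X \<and> (\<exists>x\<in>X. l = s x \<and> x \<hookrightarrow> y \<in> \<Gamma>)" for l y
  define h where "h l = (if l \<in> A \<union> B then Some (if \<exists>y. P l y then s (SOME y. P l y) else d) else None)" for l
  have dom: "dom h = A \<union> B" unfolding h_def by (auto split: if_splits)
  have P: "P (s x) y \<longleftrightarrow> x \<hookrightarrow> y \<in> \<Gamma>" if xy: "x \<in> X" "y \<in> X" for x y
    using mcs_Pto_cong[OF m _ mcs_Eq_refl[OF m], of x] s xy unfolding P_def by blast
  have "x \<hookrightarrow> y \<in> \<Gamma> \<longleftrightarrow> h (s x) = Some (s y)" if xy: "x \<in> X" "y \<in> X" for x y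
  proof
    assume p: "x \<hookrightarrow> y \<in> \<Gamma>"
    then have ex: "\<exists>y. P (s x) y" using P[OF xy] by blast
    let ?z = "SOME y. P (s x) y"
    have z: "P (s x) ?z" using someI_ex[OF ex] .
    then have "x \<hookrightarrow> ?z \<in> \<Gamma>" using P xy(1) unfolding P_def by blast
    then have "s ?z = s y" using mcs_Pto_fun[OF m p] s by metis
    moreover have "s x \<in> A" using A[OF xy(1)] mcs_Pto_Alloc[OF m p] by blast
    ultimately show "h (s x) = Some (s y)" using ex unfolding h_def by simp
  next
    assume h: "h (s x) = Some (s y)"
    have ex: "\<exists>y. P (s x) y"
    proof (rule ccontr)
      assume "\<nexists>y. P (s x) y"
      then have "s y = d" using h unfolding h_def by (simp split: if_splits)
      then show False using d xy(2) by blast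
    qed
    let ?z = "SOME y. P (s x) y"
    have z: "P (s x) ?z" using someI_ex[OF ex] .
    have "s ?z = s y" using h ex unfolding h_def by (simp split: if_splits)
    then have "?z \<^bold>= y \<in> \<Gamma>" using s by blast
    moreover have "x \<hookrightarrow> ?z \<in> \<Gamma>" using P z xy(1) unfolding P_def by blast
    ultimately show "x \<hookrightarrow> y \<in> \<Gamma>" using mcs_Pto_cong[OF m mcs_Eq_refl[OF m]] by blast
  qed
  moreover have "Alloc x \<in> \<Gamma> \<longleftrightarrow> s x \<in> dom h" if "x \<in> X" for x
    using A[OF that] B(3) that unfolding dom by blast
  moreover have "card (dom h) = b"
  proof -
    have "A \<inter> B = {}" using B(3) fA(2) by blast
    then show ?thesis unfolding dom using fA B cA by (simp add: card_Un_disjoint)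
  qed
  moreover have "finite (dom h)" unfolding dom using fA B by simp
  ultimately have "similar X \<alpha> s h \<Gamma>" unfolding similar_def using m s b(2) by simp
  then show thesis by (rule that)
qed

theorem theorem5p6:
  fixes \<phi> :: "'v::{countable, infinite} form"
  shows "valid TYPE('l::{countable, infinite}) \<phi> \<longleftrightarrow> \<turnstile> \<phi>"
proof
  assume v: "valid TYPE('l) \<phi>"
  show "\<turnstile> \<phi>"
  proof (rule derivable_if_all_mcs)
    fix \<Gamma> :: "'v form set" assume \<Gamma>: "mcs \<Gamma>"
    \<comment> \<open>The successor keeps \<open>m\<close> positive for formulae without variables,
      such as \<open>Emp\<close>.\<close>
    define X m where X: "X = set_form \<phi>" "m = Suc (card X)"
    have "finite X" unfolding X by (induction \<phi>) auto
    moreover have "card X \<le> precision m \<phi>" using le_precision[of m \<phi>] X(2) by linarith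
    ultimately obtain s :: "'v \<Rightarrow> 'l" and h where sim: "similar X (precision m \<phi>) s h \<Gamma>"
      using realize[OF \<Gamma>] by blast
    have "sat s h \<phi>" using v similarD(2)[OF sim] unfolding valid_def by blast
    then show "\<phi> \<in> \<Gamma>"
      using similar_truth[OF \<open>finite X\<close> _ _ _ order_refl sim] X by simp
  qed
next
  show "valid TYPE('l) \<phi>" if "\<turnstile> \<phi>" using sound[OF that] unfolding valid_def by blast
qed

end
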